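(* Let $n\ge 5$ be odd, let $k\ge 2$, let $a_i,b_i\in\mathbb{C}$ for $1\le i\le k$, and let $$\mathcal{L}=\mathfrak{sl}_2\mathcal{G}(a_i,b_i)=\mathfrak{sl}_2\ltimes\Big(\mathcal{GN}(a_1,b_1)*\big(\mathcal{GN}(a_2,b_2)*\cdots*\big(\mathcal{GN}(a_{k-1},b_{k-1})*\mathcal{GN}(a_k,b_k)\big)\big)\Big),$$ where each symbol $*$ is either $\ltimes$ or $\rtimes$. Then $\dim H^2(\mathcal{L},\mathcal{L})\ge1$.
   Context: All Lie algebras are finite-dimensional over $\mathbb{C}$. $H^2(\mathcal{L},\mathcal{L})$ is the second Chevalley–Eilenberg cohomology of $\mathcal{L}$ with coefficients in the adjoint module. **The algebra $\mathcal{GN}(a,b)$.** Let $n\ge5$ be odd (fixed; superscripts are indices) and let $a,b\in\mathbb{C}$. $\mathcal{GN}(a,b)$ has basis $x_1,x_2,y_1,y_2$; $c,z_1,z_2,z_3$; and, for $3\le k\le n$, $x^k_1,\dots,x^k_{k+1},y^k_1,\dots,y^k_{k+1}$. Its only nonzero brackets of basis elements, up to skew-symmetry, are: - $[x_1,x_2]=c$, $[y_1,y_2]=c$, $[x_1,y_1]=z_1$, $[x_1,y_2]=[x_2,y_1]=z_2$, $[x_2,y_2]=z_3$; - $[x_1,z_i]=x_i^3$, $[x_2,z_i]=x_{i+1}^3$, $[y_1,z_i]=y_i^3$, $[y_2,z_i]=y_{i+1}^3$ for $1\le i\le3$; - $[x_1,x_i^{k-1}]=x_i^k$, $[x_2,x_i^{k-1}]=x_{i+1}^k$,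 $[y_1,y_i^{k-1}]=y_i^k$, $[y_2,y_i^{k-1}]=y_{i+1}^k$ for $4\le k\le n-1$, $1\le i\le k$; - $[x_1,x_i^{n-1}]=x_i^n$, $[x_2,x_i^{n-1}]=x_{i+1}^n$, $[y_1,x_i^{n-1}]=y_i^n$, $[y_2,x_i^{n-1}]=y_{i+1}^n$ for $1\le i\le n$; - $[z_j,x_i^{n-2}]=-y^n_{i+j-1}$ for $1\le i\le n-1$, $1\le j\le3$; - $[x_j^p,x_i^{n-p}]=(-1)^{p-1}y^n_{i+j-1}$ for $3\le p\le\frac{n-1}{2}$, $1\le i\le n-p+1$, $1\le j\le p+1$; - $[x_j,y_i^n]=a\,(i-1-(j-1)n)\,y^{n-1}_{i+j-2}$ and $[y_j,x_i^n]=-b\,(i-1-(j-1)n)\,y^{n-1}_{i+j-2}$ for $1\le i\le n+1$, $1\le j\le2$; - $[x_j^p,x_i^{n-p+1}]=\frac{(p-1)a+b}{p}(-1)^p\big((i-1)p-(j-1)(n-p+1)\big)y^{n-1}_{i+j-2}$ for $2\le p\le\frac{n-1}{2}+1$, $1\le i\le n-p+2$, $1\le j\le p+1$, where $x_j^2:=z_j$. (Terms with out-of-range index have coefficient zero.) **Action of $\mathfrak{sl}_2$.** With basis $e,f,h$ ($[e,f]=h$, $[h,e]=2e$, $[h,f]=-2f$), $\mathfrak{sl}_2$ acts by $[h,v_i^k]=(k+2-2i)v_i^k$, $[e,v_i^k]=(i-1)v_{i-1}^k$, $[f,v_i^k]=(k+1-i)v_{i+1}^k$ for $v\in\{x,y\}$,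 $k\in\{1,3,\dots,n\}$, $1\le i\le k+1$ (with $x_i^1=x_i$, $y_i^1=y_i$); $[h,z_i]=(4-2i)z_i$, $[e,z_i]=(i-1)z_{i-1}$, $[f,z_i]=(3-i)z_{i+1}$; $[\mathfrak{sl}_2,c]=0$. On an iterated product it acts in this way on each factor. **Semidirect products.** For Lie algebras $\mathcal{G}_1,\mathcal{G}_2$ and a homomorphism $\phi:\mathcal{G}_2\to\mathrm{Der}(\mathcal{G}_1)$, $\mathcal{G}_1\rtimes\mathcal{G}_2$ is $\mathcal{G}_1\oplus\mathcal{G}_2$ with $[(g_1,h_1),(g_2,h_2)]=([g_1,g_2]+\phi(h_1)(g_2)-\phi(h_2)(g_1),[h_1,h_2])$. In $\mathcal{G}_1\ltimes\mathcal{G}_2$ the roles are exchanged: $\mathcal{G}_2$ is the ideal and $\mathcal{G}_1$ acts on it. **The actions used.** Write $x_1^{(i)},x_2^{(i)},y_1^{(i)},y_2^{(i)}$ for the generators $x_1,x_2,y_1,y_2$ of $\mathcal{GN}(a_i,b_i)$. For $m\ne t$ let $\phi_{m,t}:\mathcal{GN}(a_m,b_m)\to\mathrm{Der}(\mathcal{GN}(a_t,b_t))$ be the Lie algebra homomorphism determined by $\phi_{m,t}(x_i^{(m)})=\mathrm{ad}_{x_i^{(t)}}$, $\phi_{m,t}(y_i^{(m)})=\mathrm{ad}_{y_i^{(t)}}$, $i=1,2$. For $1\le t<k$ let $\widetilde{\mathcal{N}}_{t+1}=\mathcal{GN}(a_{t+1},b_{t+1})*(\cdots*\mathcal{GN}(a_k,b_k))$.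 In $\mathcal{GN}(a_t,b_t)\rtimes\widetilde{\mathcal{N}}_{t+1}$ the action is $\sum_{m=t+1}^k\phi_{m,t}$ (each component $\mathcal{GN}(a_m,b_m)$ acts on $\mathcal{GN}(a_t,b_t)$ via $\phi_{m,t}$); in $\mathcal{GN}(a_t,b_t)\ltimes\widetilde{\mathcal{N}}_{t+1}$ the action is $\sum_{m=t+1}^k\phi_{t,m}$ ($\mathcal{GN}(a_t,b_t)$ acts on each component $\mathcal{GN}(a_m,b_m)$ via $\phi_{t,m}$). *)

theory Defs
  imports
    "HOL-Library.Function_Algebras"
    "HOL-Library.Product_Plus"
    "HOL-Library.Set_Algebras"
    "Jordan_Normal_Form.VS_Connect"
begin

section \<open>Complex vector spaces\<close>

class complex_vs = ab_group_add +
  fixes scaleC :: "complex \<Rightarrow> 'a \<Rightarrow> 'a" (infixr "*\<^sub>C" 75)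
  assumes scaleC_add_right: "c *\<^sub>C (u + v) = c *\<^sub>C u + c *\<^sub>C v"
    and scaleC_add_left: "(c + d) *\<^sub>C u = c *\<^sub>C u + d *\<^sub>C u"
    and scaleC_scaleC: "c *\<^sub>C d *\<^sub>C u = (c * d) *\<^sub>C u"
    and scaleC_one: "1 *\<^sub>C u = u"

instantiation complex :: complex_vs
begin
definition scaleC_complex :: "complex \<Rightarrow> complex \<Rightarrow> complex"
  where "scaleC_complex c z = c * z"
instance by standard (simp_all add: scaleC_complex_def algebra_simps)
end

instantiation "fun" :: (type, complex_vs) complex_vs
begin
definition scaleC_fun :: "complex \<Rightarrow> ('a \<Rightarrow> 'b) \<Rightarrow> 'a \<Rightarrow> 'b"
  where "scaleC_fun c f = (\<lambda>x. c *\<^sub>C f x)"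
instance
  by standard (simp_all add: fun_eq_iff scaleC_fun_def scaleC_add_right scaleC_add_left
      scaleC_scaleC scaleC_one)
end

instantiation prod :: (complex_vs, complex_vs) complex_vs
begin
definition scaleC_prod :: "complex \<Rightarrow> 'a \<times> 'b \<Rightarrow> 'a \<times> 'b"
  where "scaleC_prod c p = (c *\<^sub>C fst p, c *\<^sub>C snd p)"
instance
  by standard (simp_all add: prod_eq_iff scaleC_prod_def scaleC_add_right scaleC_add_left
      scaleC_scaleC scaleC_one)
end

definition linear_on :: "'v::complex_vs set \<Rightarrow> 'w::complex_vs set \<Rightarrow> ('v \<Rightarrow> 'w) \<Rightarrow> bool" where
  "linear_on S T f \<longleftrightarrow>
     (\<forall>u\<in>S. f u \<in> T) \<and>
     (\<forall>u\<in>S. \<forall>v\<in>S. f (u + v) = f u + f v) \<and>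
     (\<forall>c. \<forall>u\<in>S. f (c *\<^sub>C u) = c *\<^sub>C f u)"

definition bvec :: "'b \<Rightarrow> 'b \<Rightarrow> complex" where
  "bvec p = (\<lambda>q. if q = p then 1 else 0)"

definition bilinear_ext ::
  "'b set \<Rightarrow> 'c set \<Rightarrow> ('b \<Rightarrow> 'c \<Rightarrow> 'v::complex_vs) \<Rightarrow> ('b \<Rightarrow> complex) \<Rightarrow> ('c \<Rightarrow> complex) \<Rightarrow> 'v"
where
  "bilinear_ext A B m u v = (\<Sum>p\<in>A. \<Sum>q\<in>B. (u p * v q) *\<^sub>C m p q)"

text \<open>The quotient \<open>Z / B\<close> as a vector space of cosets. The fields \<open>mult\<close> and \<open>one\<close> of the record
  play no role in a module. Adding \<open>B\<close> in \<open>smult\<close> matters only for the scalar \<open>0\<close>.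
  If \<open>B\<close> is not contained in \<open>Z\<close>, this is \<open>(Z + B) / B\<close>.\<close>

definition quotient_space ::
  "'v::complex_vs set \<Rightarrow> 'v set \<Rightarrow> (complex, 'v set) module"
where
  "quotient_space Z B =
     \<lparr> carrier = (\<lambda>z. z +o B) ` Z, mult = undefined, one = undefined,
       zero = B, add = (+), smult = (\<lambda>c A. (\<lambda>v. c *\<^sub>C v) ` A + B) \<rparr>"


section \<open>Lie algebras\<close>

text \<open>The underlying space is a subset of a type; only the restriction of the bracket to it is
  meaningful. Linear maps and cochains on it are made unique by requiring the value \<open>0\<close> outside.\<close>

record 'v lie_alg =
  lspace :: "'v set"
  lbr :: "'v \<Rightarrow> 'v \<Rightarrow> 'v"

definition lie_hom ::
  "'v::complex_vs lie_alg \<Rightarrow> 'w::complex_vs lie_alg \<Rightarrow> ('v \<Rightarrow> 'w) set"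
where
  "lie_hom G H = {f. linear_on (lspace G) (lspace H) f \<and>
     (\<forall>u\<in>lspace G. \<forall>v\<in>lspace G. f (lbr G u v) = lbr H (f u) (f v))}"

definition Der :: "'v::complex_vs lie_alg \<Rightarrow> ('v \<Rightarrow> 'v) lie_alg" where
  "Der G =
     \<lparr> lspace = {D. linear_on (lspace G) (lspace G) D \<and>
         (\<forall>u\<in>lspace G. \<forall>v\<in>lspace G. D (lbr G u v) = lbr G (D u) v + lbr G u (D v)) \<and>
         (\<forall>u. u \<notin> lspace G \<longrightarrow> D u = 0)},
       lbr = (\<lambda>D E u. D (E u) - E (D u)) \<rparr>"

definition ad :: "'v::complex_vs lie_alg \<Rightarrow> 'v \<Rightarrow> 'v \<Rightarrow> 'v" where
  "ad G x = (\<lambda>u. if u \<in> lspace G then lbr G x u else 0)"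

text \<open>\<open>semidirect_r G1 G2 \<phi>\<close> is \<open>G1 \<rtimes> G2\<close> with \<open>\<phi> : G2 \<rightarrow> Der G1\<close>;
  \<open>semidirect_l G1 G2 \<phi>\<close> is \<open>G1 \<ltimes> G2\<close> with \<open>\<phi> : G1 \<rightarrow> Der G2\<close>.\<close>

definition semidirect_r ::
  "'v::complex_vs lie_alg \<Rightarrow> 'w::complex_vs lie_alg \<Rightarrow> ('w \<Rightarrow> 'v \<Rightarrow> 'v) \<Rightarrow> ('v \<times> 'w) lie_alg"
where
  "semidirect_r G1 G2 \<phi> =
     \<lparr> lspace = lspace G1 \<times> lspace G2,
       lbr = (\<lambda>(g1, h1) (g2, h2). (lbr G1 g1 g2 + \<phi> h1 g2 - \<phi> h2 g1, lbr G2 h1 h2)) \<rparr>"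

definition semidirect_l ::
  "'v::complex_vs lie_alg \<Rightarrow> 'w::complex_vs lie_alg \<Rightarrow> ('v \<Rightarrow> 'w \<Rightarrow> 'w) \<Rightarrow> ('v \<times> 'w) lie_alg"
where
  "semidirect_l G1 G2 \<phi> =
     \<lparr> lspace = lspace G1 \<times> lspace G2,
       lbr = (\<lambda>(g1, h1) (g2, h2). (lbr G1 g1 g2, lbr G2 h1 h2 + \<phi> g1 h2 - \<phi> g2 h1)) \<rparr>"

text \<open>Transport of structure along a bijection \<open>f\<close> with inverse \<open>g\<close>.\<close>

definition transport :: "('v \<Rightarrow> 'w) \<Rightarrow> ('w \<Rightarrow> 'v) \<Rightarrow> 'v lie_alg \<Rightarrow> 'w lie_alg" where
  "transport f g G = \<lparr> lspace = f ` lspace G, lbr = (\<lambda>u v. f (lbr G (g u) (g v))) \<rparr>"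


section \<open>Second cohomology with adjoint coefficients\<close>

definition cochains1 :: "'v::complex_vs lie_alg \<Rightarrow> ('v \<Rightarrow> 'v) set" where
  "cochains1 L = {\<psi>. linear_on (lspace L) (lspace L) \<psi> \<and> (\<forall>u. u \<notin> lspace L \<longrightarrow> \<psi> u = 0)}"

definition cochains2 :: "'v::complex_vs lie_alg \<Rightarrow> ('v \<Rightarrow> 'v \<Rightarrow> 'v) set" where
  "cochains2 L = {\<omega>.
     (\<forall>u\<in>lspace L. linear_on (lspace L) (lspace L) (\<lambda>v. \<omega> u v)) \<and>
     (\<forall>v\<in>lspace L. linear_on (lspace L) (lspace L) (\<lambda>u. \<omega> u v)) \<and>
     (\<forall>u\<in>lspace L. \<omega> u u = 0) \<and>
     (\<forall>u v. u \<notin> lspace L \<or> v \<notin> lspace L \<longrightarrow> \<omega> u v = 0)}"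

definition coboundary1 :: "'v::complex_vs lie_alg \<Rightarrow> ('v \<Rightarrow> 'v) \<Rightarrow> 'v \<Rightarrow> 'v \<Rightarrow> 'v" where
  "coboundary1 L \<psi> = (\<lambda>x y.
     if x \<in> lspace L \<and> y \<in> lspace L
     then lbr L x (\<psi> y) - lbr L y (\<psi> x) - \<psi> (lbr L x y) else 0)"

definition coboundary2 ::
  "'v::complex_vs lie_alg \<Rightarrow> ('v \<Rightarrow> 'v \<Rightarrow> 'v) \<Rightarrow> 'v \<Rightarrow> 'v \<Rightarrow> 'v \<Rightarrow> 'v"
where
  "coboundary2 L \<omega> = (\<lambda>x y z.
     if x \<in> lspace L \<and> y \<in> lspace L \<and> z \<in> lspace L
     then lbr L x (\<omega> y z) - lbr L y (\<omega> x z) + lbr L z (\<omega> x y)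
        - \<omega> (lbr L x y) z + \<omega> (lbr L x z) y - \<omega> (lbr L y z) x else 0)"

definition cocycles2 :: "'v::complex_vs lie_alg \<Rightarrow> ('v \<Rightarrow> 'v \<Rightarrow> 'v) set" where
  "cocycles2 L = {\<omega> \<in> cochains2 L. coboundary2 L \<omega> = 0}"

definition coboundaries2 :: "'v::complex_vs lie_alg \<Rightarrow> ('v \<Rightarrow> 'v \<Rightarrow> 'v) set" where
  "coboundaries2 L = coboundary1 L ` cochains1 L"

definition H2 :: "'v::complex_vs lie_alg \<Rightarrow> (complex, ('v \<Rightarrow> 'v \<Rightarrow> 'v) set) module" where
  "H2 L = quotient_space (cocycles2 L) (coboundaries2 L)"

definition dim_H2 :: "'v::complex_vs lie_alg \<Rightarrow> nat" where
  "dim_H2 L = vectorspace.dim class_ring (H2 L)"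


section \<open>The algebra \<open>\<G>\<N>(a, b)\<close>\<close>

text \<open>\<open>GX k i\<close> is \<open>x\<^sub>i\<^sup>k\<close> and \<open>GY k i\<close> is \<open>y\<^sub>i\<^sup>k\<close>, where \<open>x\<^sub>i\<^sup>1 = x\<^sub>i\<close>, \<open>y\<^sub>i\<^sup>1 = y\<^sub>i\<close> and
  \<open>x\<^sub>i\<^sup>2 = z\<^sub>i\<close>; there is no \<open>y\<^sub>i\<^sup>2\<close>.\<close>

datatype gn = GX nat nat | GY nat nat | GC

abbreviation "GZ i \<equiv> GX 2 i"

definition gn_basis :: "nat \<Rightarrow> gn set" where
  "gn_basis n =
     {GX k i | k i. 1 \<le> k \<and> k \<le> n \<and> 1 \<le> i \<and> i \<le> k + 1} \<union>
     {GY k i | k i. (k = 1 \<or> 3 \<le> k \<and> k \<le> n) \<and> 1 \<le> i \<and> i \<le> k + 1} \<union> {GC}"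

text \<open>The brackets as listed, in the listed order of the two arguments; \<open>0\<close> for unlisted pairs.
  The bracket \<open>[x\<^sub>j\<^sup>k, x\<^sub>i\<^sup>l]\<close> below comprises
  \<open>[x\<^sub>j, z\<^sub>i]\<close> and \<open>[x\<^sub>j, x\<^sub>i\<^sup>l]\<close> in the case \<open>k = 1\<close>, \<open>2 \<le> l \<le> n - 1\<close>,
  and \<open>[z\<^sub>j, x\<^sub>i\<^sup>n\<^sup>-\<^sup>2]\<close> and \<open>[x\<^sub>j\<^sup>k, x\<^sub>i\<^sup>n\<^sup>-\<^sup>k]\<close> in the case \<open>k + l = n\<close>.
  The lower indices need not be restricted, because only labels in \<open>gn_basis n\<close> are used.\<close>

fun gn_table :: "nat \<Rightarrow> complex \<Rightarrow> complex \<Rightarrow> gn \<Rightarrow> gn \<Rightarrow> (gn \<Rightarrow> complex)" where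
  "gn_table n a b (GX k j) (GX l i) =
    (if k = 1 \<and> l = 1 then (if j = 1 \<and> i = 2 then bvec GC else 0)
     else if k = 1 \<and> 2 \<le> l \<and> l \<le> n - 1 then bvec (GX (l + 1) (i + j - 1))
     else if 2 \<le> k \<and> k \<le> (n - 1) div 2 \<and> k + l = n
       then (-1) ^ (k - 1) *\<^sub>C bvec (GY n (i + j - 1))
     else if 2 \<le> k \<and> k \<le> (n - 1) div 2 + 1 \<and> k + l = n + 1
       then (((of_nat k - 1) * a + b) / of_nat k * (-1) ^ k
              * ((of_nat i - 1) * of_nat k - (of_nat j - 1) * of_nat (n - k + 1)))
            *\<^sub>C bvec (GY (n - 1) (i + j - 2))
     else 0)"
| "gn_table n a b (GY k j) (GY l i) =
    (if k = 1 \<and> l = 1 then (if j = 1 \<and> i = 2 then bvec GC else 0)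
     else if k = 1 \<and> 3 \<le> l \<and> l \<le> n - 2 then bvec (GY (l + 1) (i + j - 1))
     else 0)"
| "gn_table n a b (GX k j) (GY l i) =
    (if k = 1 \<and> l = 1 then bvec (GZ (i + j - 1))
     else if k = 1 \<and> l = n
       then (a * (of_nat i - 1 - (of_nat j - 1) * of_nat n)) *\<^sub>C bvec (GY (n - 1) (i + j - 2))
     else 0)"
| "gn_table n a b (GY k j) (GX l i) =
    (if k = 1 \<and> l = 2 then bvec (GY 3 (i + j - 1))
     else if k = 1 \<and> l = n - 1 then bvec (GY n (i + j - 1))
     else if k = 1 \<and> l = n
       then (- b * (of_nat i - 1 - (of_nat j - 1) * of_nat n)) *\<^sub>C bvec (GY (n - 1) (i + j - 2))
     else 0)"
| "gn_table n a b _ _ = 0"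

text \<open>Skew-symmetric completion. Both orders are listed only for \<open>[x\<^sub>j\<^sup>k, x\<^sub>i\<^sup>k]\<close> with \<open>2k = n + 1\<close>,
  and then the two entries are negatives of each other.\<close>

definition gn_br :: "nat \<Rightarrow> complex \<Rightarrow> complex \<Rightarrow> gn \<Rightarrow> gn \<Rightarrow> (gn \<Rightarrow> complex)" where
  "gn_br n a b p q =
     (if gn_table n a b p q \<noteq> 0 then gn_table n a b p q else - gn_table n a b q p)"

text \<open>Evaluating the Jacobi identity on \<open>x\<^sub>1, y\<^sub>2, x\<^sub>i\<^sup>n\<^sup>-\<^sup>1\<close> and \<open>x\<^sub>2, y\<^sub>1, x\<^sub>i\<^sup>n\<^sup>-\<^sup>1\<close> and using
  \<open>[x\<^sub>1, y\<^sub>2] = [x\<^sub>2, y\<^sub>1]\<close> shows that it fails for the listed brackets if \<open>a \<noteq> b\<close>. The definitions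
  below do not presuppose it and make sense for all \<open>a\<close>, \<open>b\<close>.\<close>

definition GN :: "nat \<Rightarrow> complex \<Rightarrow> complex \<Rightarrow> (gn \<Rightarrow> complex) lie_alg" where
  "GN n a b =
     \<lparr> lspace = {u. \<forall>p. p \<notin> gn_basis n \<longrightarrow> u p = 0},
       lbr = bilinear_ext (gn_basis n) (gn_basis n) (gn_br n a b) \<rparr>"


section \<open>The action of \<open>\<ss>\<ll>\<^sub>2\<close>\<close>

datatype sl2 = E | F | H

fun sl2_br :: "sl2 \<Rightarrow> sl2 \<Rightarrow> (sl2 \<Rightarrow> complex)" where
  "sl2_br E F = bvec H"
| "sl2_br F E = - bvec H"
| "sl2_br H E = 2 *\<^sub>C bvec E"
| "sl2_br E H = - 2 *\<^sub>C bvec E"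
| "sl2_br H F = - 2 *\<^sub>C bvec F"
| "sl2_br F H = 2 *\<^sub>C bvec F"
| "sl2_br _ _ = 0"

definition SL2 :: "(sl2 \<Rightarrow> complex) lie_alg" where
  "SL2 = \<lparr> lspace = UNIV, lbr = bilinear_ext {E, F, H} {E, F, H} sl2_br \<rparr>"

fun sl2_gn :: "sl2 \<Rightarrow> gn \<Rightarrow> (gn \<Rightarrow> complex)" where
  "sl2_gn H (GX k i) = (of_nat k + 2 - 2 * of_nat i) *\<^sub>C bvec (GX k i)"
| "sl2_gn E (GX k i) = (of_nat i - 1) *\<^sub>C bvec (GX k (i - 1))"
| "sl2_gn F (GX k i) = (of_nat k + 1 - of_nat i) *\<^sub>C bvec (GX k (i + 1))"
| "sl2_gn H (GY k i) = (of_nat k + 2 - 2 * of_nat i) *\<^sub>C bvec (GY k i)"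
| "sl2_gn E (GY k i) = (of_nat i - 1) *\<^sub>C bvec (GY k (i - 1))"
| "sl2_gn F (GY k i) = (of_nat k + 1 - of_nat i) *\<^sub>C bvec (GY k (i + 1))"
| "sl2_gn _ GC = 0"

definition sl2_act :: "nat \<Rightarrow> (sl2 \<Rightarrow> complex) \<Rightarrow> (gn \<Rightarrow> complex) \<Rightarrow> (gn \<Rightarrow> complex)" where
  "sl2_act n = bilinear_ext {E, F, H} (gn_basis n) sl2_gn"


section \<open>The homomorphisms \<open>\<phi>\<^sub>m\<^sub>,\<^sub>t\<close>\<close>

text \<open>All algebras \<open>GN n a b\<close> with the same \<open>n\<close> have the same underlying space and the same basis
  labels, so a vector of \<open>GN n (a m) (b m)\<close> may be read as a vector of \<open>GN n (a t) (b t)\<close>.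
  The lemma \<open>phi_unique\<close> below shows that this is the only candidate for the homomorphism
  sending the generators \<open>x\<^sub>i\<close>, \<open>y\<^sub>i\<close> of the first algebra to \<open>ad x\<^sub>i\<close>, \<open>ad y\<^sub>i\<close> of the second.\<close>

definition phi ::
  "nat \<Rightarrow> (nat \<Rightarrow> complex) \<Rightarrow> (nat \<Rightarrow> complex) \<Rightarrow> nat \<Rightarrow> nat
     \<Rightarrow> (gn \<Rightarrow> complex) \<Rightarrow> (gn \<Rightarrow> complex) \<Rightarrow> (gn \<Rightarrow> complex)"
where
  "phi n a b m t v = ad (GN n (a t) (b t)) v"


lemma scaleC_zero [simp]: "0 *\<^sub>C (v::'v::complex_vs) = 0" "c *\<^sub>C (0::'v) = 0"
proof -
  have "0 *\<^sub>C v + 0 *\<^sub>C v = 0 *\<^sub>C v"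
    by (simp flip: scaleC_add_left)
  then show "0 *\<^sub>C v = 0" by simp
  have "c *\<^sub>C (0::'v) + c *\<^sub>C (0::'v) = c *\<^sub>C (0::'v)"
    by (simp flip: scaleC_add_right)
  then show "c *\<^sub>C (0::'v) = 0" by simp
qed

lemma scaleC_sum_right: "c *\<^sub>C (\<Sum>x\<in>A. f x) = (\<Sum>x\<in>A. c *\<^sub>C (f x :: 'v::complex_vs))"
  by (induction A rule: infinite_finite_induct) (simp_all add: scaleC_add_right)

lemma sum_fun_apply: "(\<Sum>x\<in>A. f x) y = (\<Sum>x\<in>A. (f x y :: 'v::comm_monoid_add))"
  by (induction A rule: infinite_finite_induct) simp_all

lemma finite_gn_basis [simp]: "finite (gn_basis n)"
proof -
  have "gn_basis n \<subseteq> (\<lambda>(k, i). GX k i) ` ({..n} \<times> {..n+2}) \<union>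
          (\<lambda>(k, i). GY k i) ` ({..n+1} \<times> {..n+2}) \<union> {GC}"
    by (auto simp: gn_basis_def image_iff)
  then show ?thesis by (rule finite_subset) auto
qed

lemma bilinear_ext_bvec:
  assumes "finite A" "finite B" "p \<in> A" "q \<in> B"
  shows "bilinear_ext A B m (bvec p) (bvec q) = m p q"
proof -
  have "bilinear_ext A B m (bvec p) (bvec q)
      = (\<Sum>p'\<in>A. if p' = p then (\<Sum>q'\<in>B. if q' = q then m p' q' else 0) else 0)"
    unfolding bilinear_ext_def
    by (intro sum.cong refl) (auto simp: bvec_def scaleC_one intro!: sum.cong)
  then show ?thesis using assms by simp
qed

lemma bilinear_ext_add_left:
  "bilinear_ext A B m (u + u') v = bilinear_ext A B m u v + bilinear_ext A B m u' v"
  unfolding bilinear_ext_def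
  by (simp add: sum.distrib distrib_right scaleC_add_left)

lemma bilinear_ext_scale_left:
  "bilinear_ext A B m (c *\<^sub>C u) v = c *\<^sub>C bilinear_ext A B m u v"
  unfolding bilinear_ext_def
  by (simp add: scaleC_sum_right scaleC_fun_def scaleC_complex_def scaleC_scaleC mult.assoc)

lemma bilinear_ext_zero_left: "bilinear_ext A B m 0 v = 0"
  using bilinear_ext_scale_left[of A B m 0 0 v] by simp

lemma lbr_GN_bvec:
  "p \<in> gn_basis n \<Longrightarrow> q \<in> gn_basis n \<Longrightarrow> lbr (GN n a b) (bvec p) (bvec q) = gn_br n a b p q"
  by (simp add: GN_def bilinear_ext_bvec)

lemma bvec_mem: "p \<in> gn_basis n \<Longrightarrow> bvec p \<in> lspace (GN n a b)"
  by (auto simp: GN_def bvec_def)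

lemma bvec_nonzero [simp]: "bvec p \<noteq> 0"
  by (auto simp: bvec_def fun_eq_iff)

lemma phi_unique:
  fixes a b :: "nat \<Rightarrow> complex"
  assumes n: "5 \<le> n"
    and f: "f \<in> lie_hom (GN n (a m) (b m)) (Der (GN n (a t) (b t)))"
    and fx: "\<And>i. i \<in> {1, 2} \<Longrightarrow> f (bvec (GX 1 i)) = ad (GN n (a t) (b t)) (bvec (GX 1 i))"
    and fy: "\<And>i. i \<in> {1, 2} \<Longrightarrow> f (bvec (GY 1 i)) = ad (GN n (a t) (b t)) (bvec (GY 1 i))"
    and v: "v \<in> lspace (GN n (a m) (b m))"
  shows "f v = phi n a b m t v"
proof -
  define G where "G = GN n (a m) (b m)"
  define G' where "G' = GN n (a t) (b t)"
  have sp: "lspace G = lspace G'" by (simp add: G_def G'_def GN_def)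
  have fD: "f u \<in> lspace (Der G')" if "u \<in> lspace G" for u
    using f that by (auto simp: lie_hom_def linear_on_def G_def G'_def)
  have fbr: "f (lbr G u v) = lbr (Der G') (f u) (f v)" if "u \<in> lspace G" "v \<in> lspace G" for u v
    using f that by (auto simp: lie_hom_def G_def G'_def)
  have key: "f (lbr G u v) = ad G' (lbr G' u v)"
    if u: "u \<in> lspace G" and v: "v \<in> lspace G" and fu: "f u = ad G' u" and fv: "f v = ad G' v"
    for u v
  proof
    fix w
    have U: "ad G' u \<in> lspace (Der G')" and V: "ad G' v \<in> lspace (Der G')"
      using fD[OF u] fD[OF v] fu fv by auto
    show "f (lbr G u v) w = ad G' (lbr G' u v) w"
    proof (cases "w \<in> lspace G'")
      case True
      have "lbr G' v w \<in> lspace G'" "lbr G' u w \<in> lspace G'"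
        using U V True by (auto simp: Der_def linear_on_def ad_def split: if_splits)
      moreover have "ad G' u (lbr G' v w) = lbr G' (ad G' u v) w + lbr G' v (ad G' u w)"
        using U True v sp by (auto simp: Der_def)
      ultimately show ?thesis
        using True u v sp by (simp add: fbr fu fv Der_def ad_def)
    next
      case False
      have z: "(0::gn \<Rightarrow> complex) \<in> lspace G'" by (simp add: G'_def GN_def)
      have "ad G' u (0 *\<^sub>C 0) = 0 *\<^sub>C ad G' u 0" "ad G' v (0 *\<^sub>C 0) = 0 *\<^sub>C ad G' v 0"
        using U V z unfolding Der_def linear_on_def by fastforce+
      then have "ad G' u 0 = 0" "ad G' v 0 = 0" by simp_all
      then show ?thesis using False u v z by (simp add: fbr fu fv Der_def ad_def)
    qed
  qed
  define good where "good = (\<lambda>p. f (bvec p) = ad G' (bvec p))"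
  have step: "good r"
    if "p \<in> gn_basis n" "q \<in> gn_basis n" "good p" "good q"
      "\<And>a b. gn_br n a b p q = bvec r" for p q r
  proof -
    have "lbr G (bvec p) (bvec q) = bvec r" "lbr G' (bvec p) (bvec q) = bvec r"
      using that by (simp_all add: G_def G'_def lbr_GN_bvec)
    with key[of "bvec p" "bvec q"] that show ?thesis
      by (simp add: good_def G_def bvec_mem)
  qed
  have mem: "GX k i \<in> gn_basis n \<longleftrightarrow> 1 \<le> k \<and> k \<le> n \<and> 1 \<le> i \<and> i \<le> k + 1"
    "GY k i \<in> gn_basis n \<longleftrightarrow> (k = 1 \<or> 3 \<le> k \<and> k \<le> n) \<and> 1 \<le> i \<and> i \<le> k + 1" for k i
    by (auto simp: gn_basis_def)
  have X1: "good (GX 1 1)" "good (GX 1 2)" using fx by (simp_all add: good_def G'_def)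
  have Y1: "good (GY 1 1)" "good (GY 1 2)" using fy by (simp_all add: good_def G'_def)
  have gc: "good GC"
    by (rule step[OF _ _ X1]) (use n in \<open>simp_all add: mem gn_br_def\<close>)
  have z1: "good (GX 2 1)"
    by (rule step[OF _ _ X1(1) Y1(1)]) (use n in \<open>simp_all add: mem gn_br_def\<close>)
  have z2: "good (GX 2 2)"
    by (rule step[OF _ _ X1(1) Y1(2)]) (use n in \<open>simp_all add: mem gn_br_def\<close>)
  have z3: "good (GX 2 3)"
    by (rule step[OF _ _ X1(2) Y1(2)]) (use n in \<open>simp_all add: mem gn_br_def\<close>)
  have X2: "good (GX 2 i)" if "1 \<le> i" "i \<le> 3" for i
  proof -
    from that have "i = 1 \<or> i = 2 \<or> i = 3" by linarith
    then show ?thesis using z1 z2 z3 by blast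
  qed
  have Xstep: "good (GX (Suc k) i)"
    if k: "2 \<le> k" "k \<le> n - 1" and IH: "\<And>i. 1 \<le> i \<Longrightarrow> i \<le> k + 1 \<Longrightarrow> good (GX k i)"
      and i: "1 \<le> i" "i \<le> k + 2" for k i
  proof (cases "i \<le> k + 1")
    case True
    show ?thesis
      by (rule step[OF _ _ X1(1) IH[OF i(1) True]])
        (use n k i True in \<open>simp_all add: mem gn_br_def\<close>)
  next
    case False
    with i have i': "i = k + 2" by simp
    show ?thesis unfolding i'
      by (rule step[OF _ _ X1(2) IH[of "k + 1"]])
        (use n k in \<open>simp_all add: mem gn_br_def\<close>)
  qed
  have X: "good (GX k i)" if "2 \<le> k" "k \<le> n" "1 \<le> i" "i \<le> k + 1" for k i
    using that
  proof (induction k arbitrary: i rule: dec_induct)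
    case base
    then show ?case using X2 by simp
  next
    case (step k)
    then show ?case by (intro Xstep) simp_all
  qed
  have Y3: "good (GY 3 i)" if i: "1 \<le> i" "i \<le> 4" for i
  proof (cases "i \<le> 3")
    case True
    show ?thesis
      by (rule step[OF _ _ Y1(1) X2[OF i(1) True]])
        (use n i True in \<open>simp_all add: mem gn_br_def\<close>)
  next
    case False
    with i have i': "i = 4" by simp
    show ?thesis unfolding i'
      by (rule step[OF _ _ Y1(2) z3]) (use n in \<open>simp_all add: mem gn_br_def\<close>)
  qed
  have Ystep: "good (GY (Suc k) i)"
    if k: "3 \<le> k" "k \<le> n - 2" and IH: "\<And>i. 1 \<le> i \<Longrightarrow> i \<le> k + 1 \<Longrightarrow> good (GY k i)"
      and i: "1 \<le> i" "i \<le> k + 2" for k i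
  proof (cases "i \<le> k + 1")
    case True
    show ?thesis
      by (rule step[OF _ _ Y1(1) IH[OF i(1) True]])
        (use n k i True in \<open>simp_all add: mem gn_br_def\<close>)
  next
    case False
    with i have i': "i = k + 2" by simp
    show ?thesis unfolding i'
      by (rule step[OF _ _ Y1(2) IH[of "k + 1"]])
        (use n k in \<open>simp_all add: mem gn_br_def\<close>)
  qed
  have Ylow: "good (GY k i)" if "3 \<le> k" "k \<le> n - 1" "1 \<le> i" "i \<le> k + 1" for k i
    using that
  proof (induction k arbitrary: i rule: dec_induct)
    case base
    then show ?case using Y3 by simp
  next
    case (step k)
    then show ?case by (intro Ystep) simp_all
  qed
  have Yn: "good (GY n i)" if i: "1 \<le> i" "i \<le> n + 1" for i
  proof (cases "i \<le> n")
    case True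
    show ?thesis
      by (rule step[OF _ _ Y1(1) X[of "n - 1" i]])
        (use n i True in \<open>auto simp: mem gn_br_def\<close>)
  next
    case False
    with i have i': "i = n + 1" by simp
    show ?thesis unfolding i'
      by (rule step[OF _ _ Y1(2) X[of "n - 1" n]])
        (use n in \<open>auto simp: mem gn_br_def\<close>)
  qed
  have good: "good p" if "p \<in> gn_basis n" for p
  proof (cases p)
    case (GX k i)
    then have "k = 1 \<and> (i = 1 \<or> i = 2) \<or> 2 \<le> k \<and> k \<le> n \<and> 1 \<le> i \<and> i \<le> k + 1"
      using that by (auto simp: mem)
    then show ?thesis using GX X1 X by blast
  next
    case (GY k i)
    then have "k = 1 \<and> (i = 1 \<or> i = 2) \<or> 3 \<le> k \<and> k \<le> n - 1 \<and> 1 \<le> i \<and> i \<le> k + 1 \<or>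
        k = n \<and> 1 \<le> i \<and> i \<le> n + 1"
      using that by (auto simp: mem)
    then show ?thesis using GY Y1 Ylow Yn by blast
  next
    case GC
    then show ?thesis using gc by simp
  qed
  have flin: "f (u + w) = f u + f w" "f (c *\<^sub>C u) = c *\<^sub>C f u"
    if "u \<in> lspace G" "w \<in> lspace G" for u w c
    using f that by (auto simp: lie_hom_def linear_on_def G_def)
  have adlin: "ad G' (u + w) = ad G' u + ad G' w" "ad G' (c *\<^sub>C u) = c *\<^sub>C ad G' u" for u w c
    by (auto simp: ad_def fun_eq_iff G'_def GN_def scaleC_fun_def
        bilinear_ext_add_left bilinear_ext_scale_left[unfolded scaleC_fun_def])
  have sum: "(\<Sum>p\<in>S. v p *\<^sub>C bvec p) \<in> lspace G \<and>
      f (\<Sum>p\<in>S. v p *\<^sub>C bvec p) = ad G' (\<Sum>p\<in>S. v p *\<^sub>C bvec p)"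
    if "finite S" "S \<subseteq> gn_basis n" for S
    using that
  proof (induction S rule: finite_induct)
    case empty
    have z: "0 \<in> lspace G" by (simp add: G_def GN_def)
    show ?case using flin(2)[OF z z, of 0] adlin(2)[of 0 0] z by (simp add: zero_fun_def)
  next
    case (insert p S)
    have p: "bvec p \<in> lspace G" using insert by (auto simp: G_def bvec_mem)
    have p': "v p *\<^sub>C bvec p \<in> lspace G" using p by (auto simp: G_def GN_def scaleC_fun_def)
    have "f (v p *\<^sub>C bvec p) = ad G' (v p *\<^sub>C bvec p)"
      using good[of p] insert.prems p by (simp add: flin(2) adlin good_def)
    moreover define r where "r = (\<Sum>p\<in>S. v p *\<^sub>C bvec p)"
    moreover have "r \<in> lspace G" "f r = ad G' r" using insert by (auto simp: r_def)
    moreover have "v p *\<^sub>C bvec p + r \<in> lspace G"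
      using p' \<open>r \<in> lspace G\<close> by (auto simp: G_def GN_def)
    ultimately have "f (v p *\<^sub>C bvec p + r) = ad G' (v p *\<^sub>C bvec p + r)"
      using p' by (simp only: flin(1) adlin(1))
    moreover have "(\<Sum>q\<in>insert p S. v q *\<^sub>C bvec q) = v p *\<^sub>C bvec p + r"
      unfolding r_def by (rule sum.insert) (use insert in auto)
    ultimately show ?case using \<open>v p *\<^sub>C bvec p + r \<in> lspace G\<close> by (simp only:)
  qed
  have "v = (\<Sum>p\<in>gn_basis n. v p *\<^sub>C bvec p)"
  proof
    fix q
    have "(\<Sum>p\<in>gn_basis n. v p *\<^sub>C bvec p) q = (\<Sum>p\<in>gn_basis n. if p = q then v q else 0)"
      unfolding sum_fun_apply
      by (rule sum.cong) (simp_all add: scaleC_fun_def scaleC_complex_def bvec_def)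
    then show "v q = (\<Sum>p\<in>gn_basis n. v p *\<^sub>C bvec p) q"
      using v by (auto simp: GN_def)
  qed
  then show ?thesis using sum[of "gn_basis n"] by (simp add: phi_def G'_def)
qed


section \<open>Iterated products\<close>

datatype side = LTimes | RTimes

text \<open>\<open>iter_prod n k a b s t\<close>, for \<open>1 \<le> t \<le> k\<close>, is
  \<open>GN n (a t) (b t) * (\<dots> * GN n (a k) (b k))\<close>, where the symbol following the factor \<open>t\<close> is \<open>s t\<close>.
  A vector is a family indexed by \<open>{t..k}\<close>, extended by \<open>0\<close>;
  the pair \<open>(g, h)\<close> of a vector \<open>g\<close> in the factor \<open>t\<close> and
  a vector \<open>h\<close> in the product of the factors \<open>t + 1, \<dots>, k\<close> is identified with \<open>h(t := g)\<close>.\<close>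

function iter_prod ::
  "nat \<Rightarrow> nat \<Rightarrow> (nat \<Rightarrow> complex) \<Rightarrow> (nat \<Rightarrow> complex) \<Rightarrow> (nat \<Rightarrow> side) \<Rightarrow> nat
     \<Rightarrow> (nat \<Rightarrow> gn \<Rightarrow> complex) lie_alg"
where
  "iter_prod n k a b s t =
    (if t < k then
       transport (\<lambda>(g, h). h(t := g)) (\<lambda>u. (u t, u(t := 0)))
         (case s t of
            RTimes \<Rightarrow> semidirect_r (GN n (a t) (b t)) (iter_prod n k a b s (t + 1))
              (\<lambda>h g. \<Sum>m\<in>{t+1..k}. phi n a b m t (h m) g)
          | LTimes \<Rightarrow> semidirect_l (GN n (a t) (b t)) (iter_prod n k a b s (t + 1))
              (\<lambda>g h m. if m \<in> {t+1..k} then phi n a b t m g (h m) else 0))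
     else transport (\<lambda>g. (\<lambda>_. 0)(t := g)) (\<lambda>u. u t) (GN n (a t) (b t)))"
  by pat_completeness auto
termination by (relation "measure (\<lambda>(n, k, a, b, s, t). k - t)") auto

definition sl2_GN ::
  "nat \<Rightarrow> nat \<Rightarrow> (nat \<Rightarrow> complex) \<Rightarrow> (nat \<Rightarrow> complex) \<Rightarrow> (nat \<Rightarrow> side)
     \<Rightarrow> ((sl2 \<Rightarrow> complex) \<times> (nat \<Rightarrow> gn \<Rightarrow> complex)) lie_alg"
where
  "sl2_GN n k a b s =
     semidirect_l SL2 (iter_prod n k a b s 1) (\<lambda>g u m. sl2_act n g (u m))"

end

theory Submission
  imports Defs
begin

text \<open>The relation that one factor acts on another is a linear order on the factors. Let \<open>M\<close> be the
  factor on which no other one acts, and \<open>q\<close> another factor, so that \<open>M\<close> acts on \<open>q\<close>. The element \<open>c\<close>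
  of \<open>M\<close> is central in \<open>\<L>\<close>, and no bracket of the iterated product has a component along a
  generator \<open>x\<^sub>i\<close>. Hence \<open>\<omega> = B \<otimes> c\<close> is a cocycle for every \<open>\<ss>\<ll>\<^sub>2\<close>-invariant alternating form \<open>B\<close> in the
  coordinates along these generators; no Jacobi identity is involved. We take for \<open>B\<close> the form
  pairing the \<open>x\<^sub>i\<close> of \<open>M\<close> with the \<open>x\<^sub>i\<close> of \<open>q\<close>.

  Suppose \<open>\<omega> = d\<psi>\<close>. Let \<open>w\<close> be the vector \<open>x\<^sub>2\<close> of \<open>q\<close>, and for \<open>g = x\<^sub>1, y\<^sub>1\<close> let \<open>D\<^sub>g\<close> be the copy of
  \<open>g\<close> in \<open>M\<close> minus its copy in \<open>q\<close>, so that \<open>[D\<^sub>g, w] = 0\<close>. As nothing acts on \<open>M\<close>, the \<open>M\<close>-component of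
  \<open>\<omega>(D\<^sub>g, w) = [D\<^sub>g, \<psi>(w)] - [w, \<psi>(D\<^sub>g)]\<close> is that of \<open>[g, \<psi>(w)]\<close>. If \<open>P\<close> is the coefficient of \<open>x\<^sub>2\<close> in the
  \<open>M\<close>-component of \<open>\<psi>(w)\<close>, then \<open>g = y\<^sub>1\<close> yields \<open>P = 0\<close> (coefficient of \<open>z\<^sub>2\<close>), while \<open>g = x\<^sub>1\<close> yields
  \<open>P = 1\<close> (coefficient of \<open>c\<close>).\<close>

section \<open>Quotients of complex vector spaces\<close>

text \<open>Makes the theory of spans and independence available on \<open>complex_vs\<close>. Since
  \<open>dim_H2\<close> is stated in the locale \<open>vectorspace\<close> with explicit carriers,
  the quotient has to connect the two settings.\<close>

interpretation cvs: vector_space "scaleC :: complex \<Rightarrow> 'v \<Rightarrow> 'v::complex_vs"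
  by standard (simp_all add: scaleC_add_right scaleC_add_left scaleC_scaleC scaleC_one)

lemma coset_add:
  assumes "cvs.subspace B"
  shows "(x +o B) + (y +o B) = (x + y) +o B"
proof -
  have "B + B = B"
  proof
    show "B + B \<subseteq> B"
      using cvs.subspace_add[OF assms] by (auto simp: set_plus_def)
    show "B \<subseteq> B + B"
      using cvs.subspace_0[OF assms] by (metis add_0 set_plus_intro subsetI)
  qed
  then show ?thesis by (simp add: set_plus_rearrange)
qed

lemma coset_scale:
  assumes "cvs.subspace B"
  shows "(\<lambda>v. c *\<^sub>C v) ` (x +o B) + B = (c *\<^sub>C x) +o B"
proof
  show "(\<lambda>v. c *\<^sub>C v) ` (x +o B) + B \<subseteq> (c *\<^sub>C x) +o B"
    using assms
    by (auto simp: set_plus_def elt_set_plus_def scaleC_add_right add.assoc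
        intro!: cvs.subspace_add cvs.subspace_scale)
  show "(c *\<^sub>C x) +o B \<subseteq> (\<lambda>v. c *\<^sub>C v) ` (x +o B) + B"
    using cvs.subspace_0[OF assms] by (force simp: set_plus_def elt_set_plus_def)
qed

text \<open>For a different from b the Jacobi identity fails and coboundaries need not be cocycles.
  The statement therefore covers (Z + B) / B for any two subspaces.\<close>

lemma vectorspace_quotient_space:
  assumes Z: "cvs.subspace Z" and B: "cvs.subspace B"
  shows "vectorspace class_ring (quotient_space Z B)"
proof -
  let ?Q = "quotient_space Z B"
  have carrier: "carrier ?Q = (\<lambda>z. z +o B) ` Z"
    and add: "(x +o B) \<oplus>\<^bsub>?Q\<^esub> (y +o B) = (x + y) +o B"
    and smult: "c \<odot>\<^bsub>?Q\<^esub> (x +o B) = (c *\<^sub>C x) +o B" for x y c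
    by (simp_all add: quotient_space_def coset_add[OF B] coset_scale[OF B])
  have zero: "\<zero>\<^bsub>?Q\<^esub> = 0 +o B"
    by (simp add: quotient_space_def)
  have neg: "\<exists>w\<in>Z. (z + w) +o B = 0 +o B" if "z \<in> Z" for z
    using cvs.subspace_neg[OF Z that] by (intro bexI[of _ "- z"]) simp_all
  \<comment> \<open>Keeps the zero of the quotient in the form \<open>0 +o B\<close>, to which
    \<open>add\<close> and \<open>smult\<close> apply.\<close>
  note [simp del] = set_zero_plus
  have "module class_ring ?Q"
  proof (rule module_criteria)
    show "cring (class_ring :: complex ring)" by (rule class_cring.cring_axioms)
  qed (use neg cvs.subspace_0[OF Z] cvs.subspace_add[OF Z] cvs.subspace_scale[OF Z] in
      \<open>auto simp: carrier zero add smult scaleC_add_left scaleC_add_right scaleC_scaleC scaleC_one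
        ac_simps\<close>)
  then show ?thesis
    by (intro vectorspace.intro class_field)
qed

text \<open>\<open>dim\<close> is the least size of a finite generating set, so it carries
  information only once a finite generating set is known; this is what \<open>T\<close> provides. If
  the least size were 0, the quotient would be the single coset \<open>B\<close>, which the coset of
  \<open>z\<close> contradicts.\<close>

lemma dim_quotient_space_pos:
  assumes Z: "cvs.subspace Z" and B: "cvs.subspace B"
    and T: "finite T" "Z \<subseteq> cvs.span T"
    and z: "z \<in> Z" "z \<notin> B"
  shows "1 \<le> vectorspace.dim class_ring (quotient_space Z B)"
proof -
  let ?Q = "quotient_space Z B"
  interpret Q: vectorspace class_ring ?Q
    using Z B by (rule vectorspace_quotient_space)
  \<comment> \<open>\<open>T\<close> may lie outside \<open>Z\<close>. An independent spanning set
    inside \<open>Z\<close> is still finite, by the exchange bound against \<open>T\<close>, and its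
    cosets generate the quotient.\<close>
  obtain S where S: "S \<subseteq> Z" "cvs.independent S" "Z \<subseteq> cvs.span S"
    using cvs.maximal_independent_subset by blast
  have finS: "finite S"
    using cvs.independent_span_bound[OF T(1) S(2)] S(1) T(2) by auto
  have SQ: "(\<lambda>z. z +o B) ` S \<subseteq> carrier ?Q"
    using S(1) by (auto simp: quotient_space_def)
  interpret span: submodule class_ring "Q.span ((\<lambda>z. z +o B) ` S)" ?Q
    by (rule Q.span_is_submodule[OF SQ])
  have "carrier ?Q \<subseteq> Q.span ((\<lambda>z. z +o B) ` S)"
  proof
    fix v assume "v \<in> carrier ?Q"
    then obtain w where w: "w \<in> Z" "v = w +o B" by (auto simp: quotient_space_def)
    have "w \<in> cvs.span S" using w(1) S(3) by auto
    then have "w +o B \<in> Q.span ((\<lambda>z. z +o B) ` S)"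
    proof (induction rule: cvs.span_induct)
      case base
      have "0 +o B \<in> Q.span ((\<lambda>z. z +o B) ` S)"
        using span.zero_closed by (simp add: quotient_space_def)
      moreover have "(x + y) +o B \<in> Q.span ((\<lambda>z. z +o B) ` S)"
        if "x +o B \<in> Q.span ((\<lambda>z. z +o B) ` S)" "y +o B \<in> Q.span ((\<lambda>z. z +o B) ` S)" for x y
        using span.m_closed[OF that] by (simp add: quotient_space_def coset_add[OF B])
      moreover have "(c *\<^sub>C x) +o B \<in> Q.span ((\<lambda>z. z +o B) ` S)"
        if "x +o B \<in> Q.span ((\<lambda>z. z +o B) ` S)" for c x
        using span.smult_closed[OF _ that, of c] by (simp add: quotient_space_def coset_scale[OF B])
      ultimately show ?case by (simp add: cvs.subspace_def)
    next
      case (step x)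
      then show ?case using Q.in_own_span[OF SQ] by auto
    qed
    then show "v \<in> Q.span ((\<lambda>z. z +o B) ` S)" using w(2) by simp
  qed
  then have gen: "Q.gen_set ((\<lambda>z. z +o B) ` S)"
    using span.subset by blast
  have "\<exists>A. finite A \<and> card A = Q.dim \<and> A \<subseteq> carrier ?Q \<and> Q.gen_set A"
    unfolding Q.dim_def by (rule LeastI) (use finS SQ gen in blast)
  then obtain A where A: "finite A" "card A = Q.dim" "Q.gen_set A" by blast
  have "Q.dim \<noteq> 0"
  proof
    assume "Q.dim = 0"
    with A have "Q.gen_set {}" by simp
    then have "carrier ?Q = {B}" by (simp add: Q.span_empty) (simp add: quotient_space_def)
    moreover have "z +o B \<in> carrier ?Q" using z(1) by (simp add: quotient_space_def)
    ultimately have "z +o B = B" by simp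
    moreover have "z \<in> z +o B"
      using cvs.subspace_0[OF B] by (force simp: elt_set_plus_def)
    ultimately show False using z(2) by simp
  qed
  then show ?thesis by simp
qed


section \<open>Finite-dimensional cochains\<close>

lemma linear_on_sum:
  assumes f: "linear_on S T f" and S: "cvs.subspace S"
    and e: "\<And>i. i \<in> I \<Longrightarrow> e i \<in> S"
  shows "f (\<Sum>i\<in>I. c i *\<^sub>C e i) = (\<Sum>i\<in>I. c i *\<^sub>C f (e i))"
  using e
proof (induction I rule: infinite_finite_induct)
  case (insert i I)
  have "(\<Sum>i\<in>I. c i *\<^sub>C e i) \<in> S"
    using insert.prems by (intro cvs.subspace_sum[OF S] cvs.subspace_scale[OF S]) auto
  then show ?case
    using insert f cvs.subspace_scale[OF S] by (simp add: linear_on_def)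
next
  case (infinite I)
  then show ?case using f cvs.subspace_0[OF S] cvs.scale_zero_left
    unfolding linear_on_def by (metis sum.infinite)
next
  case empty
  then show ?case using f cvs.subspace_0[OF S] cvs.scale_zero_left
    unfolding linear_on_def by (metis sum.empty)
qed

text \<open>A bilinear map is determined by its values on pairs of basis vectors. The spanning maps
  \<tau> are the elementary tensors of two coordinates and a basis vector, cut off outside the
  space; they need not be alternating, so their span may be larger than
  \<open>cochains2 L\<close>.\<close>

lemma cochains2_finite_span:
  assumes S: "cvs.subspace (lspace L)" and I: "finite I"
    and e: "\<And>i. i \<in> I \<Longrightarrow> e i \<in> lspace L"
    and coord: "\<And>u. u \<in> lspace L \<Longrightarrow> u = (\<Sum>i\<in>I. \<xi> i u *\<^sub>C e i)"
  shows "\<exists>T. finite T \<and> cochains2 L \<subseteq> cvs.span T"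
proof -
  define \<tau> where "\<tau> = (\<lambda>(i, j, l) u v. if u \<in> lspace L \<and> v \<in> lspace L then (\<xi> i u * \<xi> j v) *\<^sub>C e l else 0)"
  let ?T = "\<tau> ` (I \<times> I \<times> I)"
  have "\<omega> \<in> cvs.span ?T" if \<omega>: "\<omega> \<in> cochains2 L" for \<omega>
  proof -
    have lin1: "linear_on (lspace L) (lspace L) (\<lambda>u. \<omega> u v)" if "v \<in> lspace L" for v
      using \<omega> that by (simp add: cochains2_def)
    have lin2: "linear_on (lspace L) (lspace L) (\<lambda>v. \<omega> u v)" if "u \<in> lspace L" for u
      using \<omega> that by (simp add: cochains2_def)
    have mem: "\<omega> u v \<in> lspace L" if "u \<in> lspace L" "v \<in> lspace L" for u v
      using lin2[OF that(1)] that(2) by (simp add: linear_on_def)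
    have "\<omega> = (\<Sum>i\<in>I. \<Sum>j\<in>I. \<Sum>l\<in>I. \<xi> l (\<omega> (e i) (e j)) *\<^sub>C \<tau> (i, j, l))"
    proof (intro ext)
      fix u v
      show "\<omega> u v = (\<Sum>i\<in>I. \<Sum>j\<in>I. \<Sum>l\<in>I. \<xi> l (\<omega> (e i) (e j)) *\<^sub>C \<tau> (i, j, l)) u v"
      proof (cases "u \<in> lspace L \<and> v \<in> lspace L")
        case True
        have "\<omega> u v = (\<Sum>i\<in>I. \<xi> i u *\<^sub>C \<omega> (e i) v)"
          using linear_on_sum[OF lin1[of v] S e, of I "\<lambda>i. i" "\<lambda>i. \<xi> i u"] True coord[of u]
          by simp
        also have "\<dots> = (\<Sum>i\<in>I. \<xi> i u *\<^sub>C (\<Sum>j\<in>I. \<xi> j v *\<^sub>C \<omega> (e i) (e j)))"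
        proof (intro sum.cong refl arg_cong[of _ _ "scaleC _"])
          fix i assume "i \<in> I"
          then show "\<omega> (e i) v = (\<Sum>j\<in>I. \<xi> j v *\<^sub>C \<omega> (e i) (e j))"
            using linear_on_sum[OF lin2[of "e i"] S e, of I "\<lambda>i. i" "\<lambda>j. \<xi> j v"] True coord[of v] e
            by simp
        qed
        also have "\<dots> = (\<Sum>i\<in>I. \<xi> i u *\<^sub>C (\<Sum>j\<in>I. \<xi> j v *\<^sub>C
            (\<Sum>l\<in>I. \<xi> l (\<omega> (e i) (e j)) *\<^sub>C e l)))"
          using coord[OF mem] e by (intro sum.cong refl arg_cong[of _ _ "scaleC _"]) auto
        finally show ?thesis
          using True
          by (simp add: sum_fun_apply \<tau>_def scaleC_fun_def scaleC_sum_right scaleC_scaleC ac_simps)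
      next
        case False
        then have "\<omega> u v = 0" using \<omega> by (auto simp: cochains2_def)
        then show ?thesis using False by (auto simp: sum_fun_apply \<tau>_def scaleC_fun_def)
      qed
    qed
    also have "\<dots> \<in> cvs.span ?T"
      by (intro cvs.span_sum cvs.span_scale cvs.span_base) auto
    finally show ?thesis .
  qed
  then have "finite ?T \<and> cochains2 L \<subseteq> cvs.span ?T" using I by auto
  then show ?thesis by (rule exI)
qed

text \<open>\<open>coboundary2\<close> is linear in \<omega>: three of its terms apply a linear map
  \<open>lbr L x\<close> to a value of \<omega>, the other three evaluate \<omega> at fixed
  arguments.\<close>

lemma subspace_cocycles2:
  assumes S: "cvs.subspace (lspace L)"
    and lin: "\<And>x. x \<in> lspace L \<Longrightarrow> linear_on (lspace L) UNIV (lbr L x)"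
  shows "cvs.subspace (cocycles2 L)"
proof -
  have add: "lbr L x (y + z) = lbr L x y + lbr L x z" and
    scale: "lbr L x (c *\<^sub>C y) = c *\<^sub>C lbr L x y"
    if "x \<in> lspace L" "y \<in> lspace L" "z \<in> lspace L" for x y z c
    using lin[OF that(1)] that by (auto simp: linear_on_def)
  have zero: "lbr L x 0 = 0" if "x \<in> lspace L" for x
    using scale[OF that that that, of 0] scale[OF that _ that, of 0 0] cvs.subspace_0[OF S] by simp
  have mem: "\<omega> u v \<in> lspace L" if "\<omega> \<in> cochains2 L" "u \<in> lspace L" "v \<in> lspace L" for \<omega> u v
    using that by (auto simp: cochains2_def linear_on_def)
  have sub: "cvs.subspace (cochains2 L)"
    unfolding cvs.subspace_def
    using cvs.subspace_0[OF S] cvs.subspace_add[OF S] cvs.subspace_scale[OF S]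
    by (auto simp: cochains2_def linear_on_def scaleC_fun_def scaleC_add_right scaleC_scaleC ac_simps)
  have d: "coboundary2 L (\<omega> + \<omega>') = coboundary2 L \<omega> + coboundary2 L \<omega>'"
    "coboundary2 L (c *\<^sub>C \<omega>) = c *\<^sub>C coboundary2 L \<omega>"
    if "\<omega> \<in> cochains2 L" "\<omega>' \<in> cochains2 L" for \<omega> \<omega>' c
    using mem[OF that(1)] mem[OF that(2)]
    by (auto simp: coboundary2_def fun_eq_iff scaleC_fun_def add scale
        cvs.scale_right_distrib cvs.scale_right_diff_distrib)
  have d0: "coboundary2 L 0 = 0"
    by (auto simp: coboundary2_def fun_eq_iff zero)
  show ?thesis
    unfolding cvs.subspace_def cocycles2_def
    using cvs.subspace_0[OF sub] cvs.subspace_add[OF sub] cvs.subspace_scale[OF sub]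
    by (auto simp: d0 d cvs.scale_zero_right)
qed

lemma subspace_coboundaries2:
  assumes S: "cvs.subspace (lspace L)"
    and lin: "\<And>x. x \<in> lspace L \<Longrightarrow> linear_on (lspace L) UNIV (lbr L x)"
  shows "cvs.subspace (coboundaries2 L)"
proof -
  have add: "lbr L x (y + z) = lbr L x y + lbr L x z" and
    scale: "lbr L x (c *\<^sub>C y) = c *\<^sub>C lbr L x y"
    if "x \<in> lspace L" "y \<in> lspace L" "z \<in> lspace L" for x y z c
    using lin[OF that(1)] that by (auto simp: linear_on_def)
  have zero: "lbr L x 0 = 0" if "x \<in> lspace L" for x
    using scale[OF that that that, of 0] scale[OF that _ that, of 0 0] cvs.subspace_0[OF S] by simp
  have sub: "cvs.subspace (cochains1 L)"
    unfolding cvs.subspace_def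
    using cvs.subspace_0[OF S] cvs.subspace_add[OF S] cvs.subspace_scale[OF S]
    by (auto simp: cochains1_def linear_on_def scaleC_fun_def scaleC_add_right scaleC_scaleC ac_simps)
  have mem: "\<psi> u \<in> lspace L" if "\<psi> \<in> cochains1 L" "u \<in> lspace L" for \<psi> u
    using that by (auto simp: cochains1_def linear_on_def)
  have d: "coboundary1 L (\<psi> + \<psi>') = coboundary1 L \<psi> + coboundary1 L \<psi>'"
    "coboundary1 L (c *\<^sub>C \<psi>) = c *\<^sub>C coboundary1 L \<psi>"
    if "\<psi> \<in> cochains1 L" "\<psi>' \<in> cochains1 L" for \<psi> \<psi>' c
    using mem[OF that(1)] mem[OF that(2)]
    by (auto simp: coboundary1_def fun_eq_iff scaleC_fun_def add scale
        cvs.scale_right_distrib cvs.scale_right_diff_distrib)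
  have d0: "coboundary1 L 0 = 0"
    by (auto simp: coboundary1_def fun_eq_iff zero)
  have "0 \<in> coboundaries2 L"
    using d0 cvs.subspace_0[OF sub] unfolding coboundaries2_def by (metis imageI)
  then show ?thesis
    unfolding cvs.subspace_def coboundaries2_def
    using cvs.subspace_add[OF sub] cvs.subspace_scale[OF sub]
    by (auto simp flip: d)
qed


section \<open>The bracket of the iterated product\<close>

lemma bilinear_ext_add_right:
  "bilinear_ext A B m u (v + v') = bilinear_ext A B m u v + bilinear_ext A B m u v'"
  unfolding bilinear_ext_def
  by (simp add: sum.distrib distrib_left scaleC_add_left)

lemma bilinear_ext_scale_right:
  "bilinear_ext A B m u (c *\<^sub>C v) = c *\<^sub>C bilinear_ext A B m u v"
  unfolding bilinear_ext_def
  by (simp add: scaleC_sum_right scaleC_fun_def scaleC_complex_def scaleC_scaleC mult.left_commute)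

lemma bilinear_ext_apply:
  "bilinear_ext A B m u v r = (\<Sum>p\<in>A. \<Sum>q\<in>B. u p * v q * m p q r)"
  by (simp add: bilinear_ext_def sum_fun_apply scaleC_fun_def scaleC_complex_def)

lemma mem_lspace_GN: "u \<in> lspace (GN n a b) \<longleftrightarrow> (\<forall>p. p \<notin> gn_basis n \<longrightarrow> u p = 0)"
  by (simp add: GN_def)

lemma lbr_GN_add_left: "lbr (GN n a b) (u + u') v = lbr (GN n a b) u v + lbr (GN n a b) u' v"
  and lbr_GN_add_right: "lbr (GN n a b) u (v + v') = lbr (GN n a b) u v + lbr (GN n a b) u v'"
  and lbr_GN_scale_left: "lbr (GN n a b) (c *\<^sub>C u) v = c *\<^sub>C lbr (GN n a b) u v"
  and lbr_GN_scale_right: "lbr (GN n a b) u (c *\<^sub>C v) = c *\<^sub>C lbr (GN n a b) u v"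
  and lbr_GN_zero_left: "lbr (GN n a b) 0 v = 0"
  by (simp_all add: GN_def bilinear_ext_add_left bilinear_ext_add_right bilinear_ext_scale_left
      bilinear_ext_scale_right bilinear_ext_zero_left)

lemma lbr_GN_zero_right: "lbr (GN n a b) u 0 = 0"
  using lbr_GN_scale_right[of n a b u 0 0] by simp

lemma lbr_GN_uminus_left: "lbr (GN n a b) (- u) v = - lbr (GN n a b) u v"
  using lbr_GN_scale_left[of n a b "-1" u v] by (simp add: cvs.scale_minus_left scaleC_one)

lemma sl2_act_add_right: "sl2_act n g (u + v) = sl2_act n g u + sl2_act n g v"
  and sl2_act_scale_right: "sl2_act n g (c *\<^sub>C u) = c *\<^sub>C sl2_act n g u"
  and sl2_act_zero_left: "sl2_act n 0 u = 0"
  by (simp_all add: sl2_act_def bilinear_ext_add_right bilinear_ext_scale_right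
      bilinear_ext_zero_left)

lemma sl2_act_zero_right: "sl2_act n g 0 = 0"
  using sl2_act_scale_right[of n g 0 0] by simp

lemma gn_basis_simps [simp]:
  "GX k i \<in> gn_basis n \<longleftrightarrow> 1 \<le> k \<and> k \<le> n \<and> 1 \<le> i \<and> i \<le> k + 1"
  "GY k i \<in> gn_basis n \<longleftrightarrow> (k = 1 \<or> 3 \<le> k \<and> k \<le> n) \<and> 1 \<le> i \<and> i \<le> k + 1"
  "GC \<in> gn_basis n"
  by (auto simp: gn_basis_def)

text \<open>Only the entries along \<open>GY (n - 1) (i + j - 2)\<close> can leave the index range,
  and only at its two ends: both lower indices minimal gives index 0, both maximal gives n + 1. In
  both cases the coefficient vanishes.\<close>

lemma gn_table_closed:
  assumes n: "5 \<le> n" and p: "p \<in> gn_basis n" and q: "q \<in> gn_basis n" and r: "r \<notin> gn_basis n"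
  shows "gn_table n a b p q r = 0"
proof -
  have bvec: "bvec p' r = 0" if "p' \<in> gn_basis n" for p'
    using that r by (auto simp: bvec_def)
  have bvec': "c * bvec (GY (n - 1) m) r = 0" if "1 \<le> m \<and> m \<le> n \<or> c = 0" for c m
    using that n by (auto intro!: bvec)
  note apply_simps = scaleC_fun_def scaleC_complex_def
  show ?thesis
  proof (cases p; cases q)
    fix k j l i assume pq: "p = GX k j" "q = GX l i"
    have "bvec (GX (l + 1) (i + j - 1)) r = 0" if "k = 1" "2 \<le> l" "l \<le> n - 1"
      by (rule bvec) (use that n p q pq in auto)
    moreover have "bvec (GY n (i + j - 1)) r = 0" if "2 \<le> k" "k + l = n"
      by (rule bvec) (use that n p q pq in auto)
    moreover have "((of_nat i - 1) * of_nat k - (of_nat j - 1) * of_nat (n - k + 1))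
        * bvec (GY (n - 1) (i + j - 2)) r = 0" if kl: "k + l = n + 1"
    proof (rule bvec')
      have b: "1 \<le> i" "i \<le> l + 1" "1 \<le> j" "j \<le> k + 1" "k \<le> n"
        using p q pq by auto
      then consider "1 \<le> i + j - 2" "i + j - 2 \<le> n" | "i = 1" "j = 1" | "i = l + 1" "j = k + 1"
        using kl by linarith
      then show "1 \<le> i + j - 2 \<and> i + j - 2 \<le> n \<or>
          (of_nat i - 1) * of_nat k - (of_nat j - 1) * of_nat (n - k + 1) = (0 :: complex)"
      proof cases
        case 3
        moreover have "n - k + 1 = l" using kl b by linarith
        ultimately show ?thesis by simp
      qed auto
    qed
    moreover have "bvec GC r = 0" by (rule bvec) simp
    ultimately show ?thesis
      unfolding pq gn_table.simps by (simp add: apply_simps)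
  next
    fix k j l i assume pq: "p = GX k j" "q = GY l i"
    have "(of_nat i - 1 - (of_nat j - 1) * of_nat n) * bvec (GY (n - 1) (i + j - 2)) r = 0"
      if "k = 1" "l = n"
    proof (rule bvec')
      have "1 \<le> i" "i \<le> n + 1" "1 \<le> j" "j \<le> 2"
        using p q pq that by auto
      then consider "1 \<le> i + j - 2" "i + j - 2 \<le> n" | "i = 1" "j = 1" | "i = n + 1" "j = 2"
        by linarith
      then show "1 \<le> i + j - 2 \<and> i + j - 2 \<le> n \<or>
          of_nat i - 1 - (of_nat j - 1) * of_nat n = (0 :: complex)"
        by cases auto
    qed
    moreover have "bvec (GZ (i + j - 1)) r = 0" if "k = 1" "l = 1"
      by (rule bvec) (use that n p q pq in auto)
    ultimately show ?thesis
      unfolding pq gn_table.simps by (simp add: apply_simps)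
  next
    fix k j l i assume pq: "p = GY k j" "q = GX l i"
    have "(of_nat i - 1 - (of_nat j - 1) * of_nat n) * bvec (GY (n - 1) (i + j - 2)) r = 0"
      if "k = 1" "l = n"
    proof (rule bvec')
      have "1 \<le> i" "i \<le> n + 1" "1 \<le> j" "j \<le> 2"
        using p q pq that by auto
      then consider "1 \<le> i + j - 2" "i + j - 2 \<le> n" | "i = 1" "j = 1" | "i = n + 1" "j = 2"
        by linarith
      then show "1 \<le> i + j - 2 \<and> i + j - 2 \<le> n \<or>
          of_nat i - 1 - (of_nat j - 1) * of_nat n = (0 :: complex)"
        by cases auto
    qed
    moreover have "bvec (GY 3 (i + j - 1)) r = 0" if "k = 1" "l = 2"
      by (rule bvec) (use that n p q pq in auto)
    moreover have "bvec (GY n (i + j - 1)) r = 0" if "k = 1" "l = n - 1"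
      by (rule bvec) (use that n p q pq in auto)
    ultimately show ?thesis
      unfolding pq gn_table.simps by (simp add: apply_simps)
  next
    fix k j l i assume pq: "p = GY k j" "q = GY l i"
    have "bvec (GY (l + 1) (i + j - 1)) r = 0" if "k = 1" "3 \<le> l" "l \<le> n - 2"
      by (rule bvec) (use that n p q pq in auto)
    moreover have "bvec GC r = 0" by (rule bvec) simp
    ultimately show ?thesis
      unfolding pq gn_table.simps by (simp add: apply_simps)
  qed simp_all
qed

lemma lbr_GN_closed: "5 \<le> n \<Longrightarrow> lbr (GN n a b) u v \<in> lspace (GN n a b)"
  by (simp add: mem_lspace_GN) (simp add: GN_def bilinear_ext_apply gn_br_def gn_table_closed)

text \<open>The coefficients i - 1 of \<open>E\<close> and k + 1 - i of \<open>F\<close> vanish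
  exactly where the shifted index would leave its range.\<close>

lemma sl2_act_closed: "sl2_act n g u \<in> lspace (GN n a b)"
proof -
  have "sl2_gn x p r = 0" if "p \<in> gn_basis n" "r \<notin> gn_basis n" for x p r
    using that
    by (cases x; cases p) (auto simp: bvec_def scaleC_fun_def scaleC_complex_def not_le le_Suc_eq)
  then show ?thesis by (simp add: mem_lspace_GN sl2_act_def bilinear_ext_apply)
qed

text \<open>\<open>acts_on s r m\<close>: the factor \<open>r\<close> of the iterated product acts on the factor \<open>m\<close>.\<close>

definition acts_on :: "(nat \<Rightarrow> side) \<Rightarrow> nat \<Rightarrow> nat \<Rightarrow> bool" where
  "acts_on s r m \<longleftrightarrow> m < r \<and> s m = RTimes \<or> r < m \<and> s r = LTimes"

declare iter_prod.simps [simp del]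

lemma lspace_iter_prod:
  assumes "t \<le> k"
  shows "lspace (iter_prod n k a b s t) = {u. \<forall>m p. m \<notin> {t..k} \<or> p \<notin> gn_basis n \<longrightarrow> u m p = 0}"
  using assms
proof (induction t rule: inc_induct)
  case base
  have "u \<in> (\<lambda>g. (\<lambda>_. 0)(k := g)) ` lspace (GN n (a k) (b k))"
    if "\<forall>m p. m \<noteq> k \<or> p \<notin> gn_basis n \<longrightarrow> u m p = 0" for u
    by (rule image_eqI[of _ _ "u k"]) (use that in \<open>auto simp: fun_eq_iff mem_lspace_GN\<close>)
  then show ?case
    by (subst iter_prod.simps) (auto simp: transport_def mem_lspace_GN)
next
  case (step t)
  let ?S = "{u. \<forall>m p. m \<notin> {Suc t..k} \<or> p \<notin> gn_basis n \<longrightarrow> u m p = 0}"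
  have "u \<in> (\<lambda>(g, h). h(t := g)) ` (lspace (GN n (a t) (b t)) \<times> ?S)"
    if "\<forall>m p. m \<notin> {t..k} \<or> p \<notin> gn_basis n \<longrightarrow> u m p = 0" for u
    by (rule image_eqI[of _ _ "(u t, u(t := 0))"])
      (use that in \<open>auto simp: mem_lspace_GN not_less_eq_eq\<close>)
  moreover have "h(t := g) \<in> {u. \<forall>m p. m \<notin> {t..k} \<or> p \<notin> gn_basis n \<longrightarrow> u m p = 0}"
    if "g \<in> lspace (GN n (a t) (b t))" "h \<in> ?S" for g h
    using that step.hyps by (auto simp: mem_lspace_GN)
  ultimately show ?case
    using step
    by (subst iter_prod.simps)
      (auto simp: transport_def semidirect_l_def semidirect_r_def split: side.split)
qed

text \<open>Replaces the nesting by the relation \<open>acts_on\<close>. Induction peels off the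
  outermost factor t: for \<open>RTimes\<close> the component t receives one term for each later
  factor, for \<open>LTimes\<close> every later component receives the term with r = t.\<close>

lemma lbr_iter_prod:
  assumes "t \<le> k"
    and "u \<in> lspace (iter_prod n k a b s t)" "v \<in> lspace (iter_prod n k a b s t)"
  shows "lbr (iter_prod n k a b s t) u v = (\<lambda>m. if m \<in> {t..k} then
      lbr (GN n (a m) (b m)) (u m) (v m) + (\<Sum>r | r \<in> {t..k} \<and> acts_on s r m.
        lbr (GN n (a m) (b m)) (u r) (v m) - lbr (GN n (a m) (b m)) (v r) (u m)) else 0)"
  using assms
proof (induction t arbitrary: u v rule: inc_induct)
  case base
  have *: "{r. r \<in> {k..k} \<and> acts_on s r k} = {}" by (auto simp: acts_on_def)
  show ?case
  proof
    fix m
    show "lbr (iter_prod n k a b s k) u v m = (if m \<in> {k..k} then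
      lbr (GN n (a m) (b m)) (u m) (v m) + (\<Sum>r | r \<in> {k..k} \<and> acts_on s r m.
        lbr (GN n (a m) (b m)) (u r) (v m) - lbr (GN n (a m) (b m)) (v r) (u m)) else 0)"
    proof (cases "m = k")
      case True
      show ?thesis unfolding True *
        by (subst iter_prod.simps) (simp add: transport_def)
    next
      case False
      then show ?thesis
        by (subst iter_prod.simps) (simp add: transport_def)
    qed
  qed
next
  case (step t)
  have u: "u m \<in> lspace (GN n (a t) (b t))" "v m \<in> lspace (GN n (a t) (b t))" for m t
    using step.prems step.hyps by (auto simp: lspace_iter_prod mem_lspace_GN)
  let ?u = "u(t := 0)" and ?v = "v(t := 0)"
  have u': "?u \<in> lspace (iter_prod n k a b s (Suc t))" "?v \<in> lspace (iter_prod n k a b s (Suc t))"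
    using step.prems step.hyps by (auto simp: lspace_iter_prod not_less_eq_eq)
  define G where "G = (\<lambda>m. lbr (GN n (a m) (b m)))"
  \<comment> \<open>The cutoff in \<open>ad\<close> is inactive, because all components lie in the
    underlying space common to the factors.\<close>
  have phi: "phi n a b m r x (v i) = G r x (v i)" "phi n a b m r x (u i) = G r x (u i)" for m r x i
    using u by (simp_all add: phi_def ad_def G_def)
  have IH: "lbr (iter_prod n k a b s (Suc t)) ?u ?v m =
     G m (u m) (v m) + (\<Sum>r | r \<in> {Suc t..k} \<and> acts_on s r m. G m (u r) (v m) - G m (v r) (u m))"
    if "m \<in> {Suc t..k}" for m
    unfolding step.IH[OF u'] G_def using that by (auto intro!: arg_cong2[of _ _ _ _ "(+)"] sum.cong)
  have IH0: "lbr (iter_prod n k a b s (Suc t)) ?u ?v m = 0" if "m \<notin> {Suc t..k}" for m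
    unfolding step.IH[OF u'] using that by auto
  show ?case
  proof
    fix m
    consider "m = t" | "m \<in> {Suc t..k}" | "m \<notin> {t..k}" by fastforce
    then show "lbr (iter_prod n k a b s t) u v m = (if m \<in> {t..k} then
      lbr (GN n (a m) (b m)) (u m) (v m) + (\<Sum>r | r \<in> {t..k} \<and> acts_on s r m.
        lbr (GN n (a m) (b m)) (u r) (v m) - lbr (GN n (a m) (b m)) (v r) (u m)) else 0)"
    proof cases
      case 1
      show ?thesis
      proof (cases "s t")
        case RTimes
        have *: "{r. r \<in> {t..k} \<and> acts_on s r t} = {Suc t..k}"
          using RTimes by (auto simp: acts_on_def)
        show ?thesis unfolding 1 *
          using step.hyps RTimes
          by (subst iter_prod.simps)
            (simp add: transport_def semidirect_r_def phi sum_subtractf G_def)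
      next
        case LTimes
        have *: "{r. r \<in> {t..k} \<and> acts_on s r t} = {}"
          using LTimes by (auto simp: acts_on_def)
        show ?thesis unfolding 1 *
          using step.hyps LTimes
          by (subst iter_prod.simps) (simp add: transport_def semidirect_l_def)
      qed
    next
      case 2
      show ?thesis
      proof (cases "s t")
        case RTimes
        have "\<not> acts_on s t m" using RTimes 2 by (auto simp: acts_on_def)
        moreover have "{t..k} = insert t {Suc t..k}" using step.hyps by auto
        ultimately have *:
          "{r. r \<in> {t..k} \<and> acts_on s r m} = {r. r \<in> {Suc t..k} \<and> acts_on s r m}"
          by auto
        show ?thesis unfolding *
          using step.hyps RTimes 2 IH[OF 2]
          by (subst iter_prod.simps)
            (simp add: transport_def semidirect_r_def G_def)
      next
        case LTimes
        have *: "{r. r \<in> {t..k} \<and> acts_on s r m} = insert t {r. r \<in> {Suc t..k} \<and> acts_on s r m}"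
          using LTimes 2 by (auto simp: acts_on_def)
        show ?thesis unfolding *
          using step.hyps LTimes 2 IH[OF 2]
          by (subst iter_prod.simps)
            (simp add: transport_def semidirect_l_def phi algebra_simps G_def)
      qed
    next
      case 3
      then show ?thesis
        using step.hyps IH0[of m]
        by (subst iter_prod.simps)
          (auto simp: transport_def semidirect_l_def semidirect_r_def split: side.split)
    qed
  qed
qed

text \<open>\<open>M\<close> is the first factor followed by \<open>LTimes\<close>, or the last
  factor if there is none before it. Every earlier factor is followed by \<open>RTimes\<close>, so
  \<open>M\<close> acts on it; if there are later factors, \<open>M\<close> is followed by
  \<open>LTimes\<close> and acts on them.\<close>

lemma exists_top_factor:
  assumes "1 \<le> k"
  obtains M where "M \<in> {1..k}" "\<And>r. r \<in> {1..k} \<Longrightarrow> \<not> acts_on s r M"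
    "\<And>r. r \<in> {1..k} \<Longrightarrow> r \<noteq> M \<Longrightarrow> acts_on s M r"
proof
  define M where "M = (LEAST j. 1 \<le> j \<and> (j = k \<or> s j = LTimes))"
  have M: "1 \<le> M \<and> (M = k \<or> s M = LTimes)"
    unfolding M_def by (rule LeastI[of _ k]) (use assms in simp)
  have least: "s j = RTimes \<and> j \<noteq> k" if "1 \<le> j" "j < M" for j
    using not_less_Least[of j "\<lambda>j. 1 \<le> j \<and> (j = k \<or> s j = LTimes)"] that side.exhaust[of "s j"]
    by (auto simp: M_def)
  have "M \<le> k" unfolding M_def by (rule Least_le) (use assms in simp)
  then show "M \<in> {1..k}" using M by simp
  show "\<not> acts_on s r M" if "r \<in> {1..k}" for r
    using M least[of r] that by (auto simp: acts_on_def)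
  show "acts_on s M r" if "r \<in> {1..k}" "r \<noteq> M" for r
    using M least[of r] that \<open>M \<le> k\<close> by (auto simp: acts_on_def)
qed


section \<open>The semidirect product with \<open>\<ss>\<ll>\<^sub>2\<close>\<close>

lemma lspace_sl2_GN:
  "1 \<le> k \<Longrightarrow> lspace (sl2_GN n k a b s) =
     {x. \<forall>m p. m \<notin> {1..k} \<or> p \<notin> gn_basis n \<longrightarrow> snd x m p = 0}"
  by (auto simp: sl2_GN_def semidirect_l_def lspace_iter_prod SL2_def)

lemma lbr_sl2_GN:
  "lbr (sl2_GN n k a b s) x y =
     (lbr SL2 (fst x) (fst y),
      lbr (iter_prod n k a b s 1) (snd x) (snd y)
        + (\<lambda>m. sl2_act n (fst x) (snd y m)) - (\<lambda>m. sl2_act n (fst y) (snd x m)))"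
  by (simp add: sl2_GN_def semidirect_l_def split_beta)

lemma snd_lbr_sl2_GN:
  assumes "1 \<le> k" "x \<in> lspace (sl2_GN n k a b s)" "y \<in> lspace (sl2_GN n k a b s)"
  shows "snd (lbr (sl2_GN n k a b s) x y) m = (if m \<in> {1..k} then
      lbr (GN n (a m) (b m)) (snd x m) (snd y m) + (\<Sum>r | r \<in> {1..k} \<and> acts_on s r m.
        lbr (GN n (a m) (b m)) (snd x r) (snd y m) - lbr (GN n (a m) (b m)) (snd y r) (snd x m))
      else 0) + sl2_act n (fst x) (snd y m) - sl2_act n (fst y) (snd x m)"
proof -
  have "snd x \<in> lspace (iter_prod n k a b s 1)" "snd y \<in> lspace (iter_prod n k a b s 1)"
    using assms by (auto simp: lspace_sl2_GN lspace_iter_prod)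
  then show ?thesis
    unfolding lbr_sl2_GN using assms(1) by (simp add: lbr_iter_prod)
qed

lemma subspace_sl2_GN: "1 \<le> k \<Longrightarrow> cvs.subspace (lspace (sl2_GN n k a b s))"
  by (auto simp: cvs.subspace_def lspace_sl2_GN scaleC_prod_def scaleC_fun_def scaleC_complex_def)

text \<open>Cochains are 0 outside the space by convention, so a cochain evaluated at a bracket has
  its intended value only because brackets stay in the space.\<close>

lemma lbr_sl2_GN_closed:
  assumes "5 \<le> n" "1 \<le> k"
    and "x \<in> lspace (sl2_GN n k a b s)" "y \<in> lspace (sl2_GN n k a b s)"
  shows "lbr (sl2_GN n k a b s) x y \<in> lspace (sl2_GN n k a b s)"
proof -
  have "snd (lbr (sl2_GN n k a b s) x y) m p = 0" if mp: "m \<notin> {1..k} \<or> p \<notin> gn_basis n" for m p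
  proof (cases "m \<in> {1..k}")
    case True
    then have p: "p \<notin> gn_basis n" using mp by simp
    have "lbr (GN n c d) u v p = 0" "sl2_act n g u p = 0" for c d u v g
      using lbr_GN_closed[OF assms(1), of c d u v] sl2_act_closed[of n g u] p
      by (auto simp: mem_lspace_GN)
    then show ?thesis using assms by (simp add: snd_lbr_sl2_GN sum_fun_apply)
  next
    case False
    have "snd x m = 0" "snd y m = 0"
      using assms False by (auto simp: lspace_sl2_GN fun_eq_iff)
    then show ?thesis
      unfolding snd_lbr_sl2_GN[OF assms(2-4)] using False by (auto simp: sl2_act_zero_right)
  qed
  then show ?thesis using assms(2) by (simp add: lspace_sl2_GN)
qed

lemma linear_lbr_sl2_GN:
  assumes k: "1 \<le> k" and x: "x \<in> lspace (sl2_GN n k a b s)"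
  shows "linear_on (lspace (sl2_GN n k a b s)) UNIV (lbr (sl2_GN n k a b s) x)"
proof -
  let ?L = "sl2_GN n k a b s"
  note sub = subspace_sl2_GN[OF k, of n a b s]
  have act: "sl2_act n (g + h) u = sl2_act n g u + sl2_act n h u"
    "sl2_act n (c *\<^sub>C g) u = c *\<^sub>C sl2_act n g u" for g h u c
    by (simp_all add: sl2_act_def bilinear_ext_add_left bilinear_ext_scale_left)
  have "lbr ?L x (y + z) = lbr ?L x y + lbr ?L x z" if y: "y \<in> lspace ?L" and z: "z \<in> lspace ?L" for y z
  proof (rule prod_eqI)
    show "fst (lbr ?L x (y + z)) = fst (lbr ?L x y + lbr ?L x z)"
      by (simp add: lbr_sl2_GN SL2_def bilinear_ext_add_right)
    show "snd (lbr ?L x (y + z)) = snd (lbr ?L x y + lbr ?L x z)"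
      using snd_lbr_sl2_GN[OF k x y] snd_lbr_sl2_GN[OF k x z]
        snd_lbr_sl2_GN[OF k x cvs.subspace_add[OF sub y z]]
      by (intro ext[of "snd _ :: nat \<Rightarrow> gn \<Rightarrow> complex"])
        (simp add: lbr_GN_add_left lbr_GN_add_right sl2_act_add_right act sum.distrib sum_subtractf)
  qed
  moreover have "lbr ?L x (c *\<^sub>C y) = c *\<^sub>C lbr ?L x y" if y: "y \<in> lspace ?L" for y c
  proof (rule prod_eqI)
    show "fst (lbr ?L x (c *\<^sub>C y)) = fst (c *\<^sub>C lbr ?L x y)"
      by (simp add: lbr_sl2_GN SL2_def bilinear_ext_scale_right scaleC_prod_def)
    have "snd (lbr ?L x (c *\<^sub>C y)) m = snd (c *\<^sub>C lbr ?L x y) m" for m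
      using snd_lbr_sl2_GN[OF k x y, of m]
        snd_lbr_sl2_GN[OF k x cvs.subspace_scale[OF sub y], of c m]
      by (simp add: scaleC_prod_def scaleC_fun_def[of c "snd _ :: nat \<Rightarrow> gn \<Rightarrow> complex"]
          lbr_GN_scale_left lbr_GN_scale_right sl2_act_scale_right act scaleC_sum_right
          cvs.scale_right_distrib cvs.scale_right_diff_distrib)
    then show "snd (lbr ?L x (c *\<^sub>C y)) = snd (c *\<^sub>C lbr ?L x y)" ..
  qed
  ultimately show ?thesis by (simp add: linear_on_def)
qed

lemma cochains2_sl2_GN_finite_span:
  assumes k: "1 \<le> k"
  shows "\<exists>T. finite T \<and> cochains2 (sl2_GN n k a b s) \<subseteq> cvs.span T"
proof -
  \<comment> \<open>The basis is indexed by the disjoint union of the basis of \<open>SL2\<close>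
    and the labels of all factors; \<xi> gives the coordinates.\<close>
  define e :: "sl2 + nat \<times> gn \<Rightarrow> (sl2 \<Rightarrow> complex) \<times> (nat \<Rightarrow> gn \<Rightarrow> complex)"
    where "e = case_sum (\<lambda>p. (bvec p, 0)) (\<lambda>(m, p). (0, (\<lambda>_. 0)(m := bvec p)))"
  define \<xi> :: "sl2 + nat \<times> gn \<Rightarrow> (sl2 \<Rightarrow> complex) \<times> (nat \<Rightarrow> gn \<Rightarrow> complex) \<Rightarrow> complex"
    where "\<xi> = case_sum (\<lambda>p x. fst x p) (\<lambda>(m, p) x. snd x m p)"
  let ?I = "{E, F, H} <+> ({1..k} \<times> gn_basis n)"
  show ?thesis
  proof (rule cochains2_finite_span[OF subspace_sl2_GN[OF k], of ?I e _ _ _ _ \<xi>])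
    show "finite ?I" by simp
    show "e i \<in> lspace (sl2_GN n k a b s)" if "i \<in> ?I" for i
      using that k by (auto simp: e_def lspace_sl2_GN bvec_def)
    show "x = (\<Sum>i\<in>?I. \<xi> i x *\<^sub>C e i)" if x: "x \<in> lspace (sl2_GN n k a b s)" for x
    proof (rule prod_eqI)
      have "fst (\<Sum>i\<in>?I. \<xi> i x *\<^sub>C e i) p = fst x p" for p
        by (cases p) (simp_all add: sum.Plus fst_sum sum_fun_apply scaleC_prod_def split_beta
            e_def \<xi>_def scaleC_fun_def scaleC_complex_def bvec_def)
      then show "fst x = fst (\<Sum>i\<in>?I. \<xi> i x *\<^sub>C e i)" by auto
      have "(\<xi> (Inl i) x *\<^sub>C snd (e (Inl i))) m p = 0" for i m p
        by (simp add: e_def scaleC_fun_def scaleC_complex_def)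
      moreover have "(\<xi> (Inr i) x *\<^sub>C snd (e (Inr i))) m p = (if i = (m, p) then snd x m p else 0)"
        for i m p
        by (cases i) (auto simp: e_def \<xi>_def scaleC_fun_def scaleC_complex_def bvec_def)
      ultimately have "snd (\<Sum>i\<in>?I. \<xi> i x *\<^sub>C e i) m p = snd x m p" for m p
        using x k by (simp add: sum.Plus snd_sum sum_fun_apply scaleC_prod_def)
          (auto simp: lspace_sl2_GN)
      then show "snd x = snd (\<Sum>i\<in>?I. \<xi> i x *\<^sub>C e i)" by (intro ext) (simp only:)
    qed
  qed
qed


section \<open>The cocycle\<close>

text \<open>Brackets land on c, on some x with upper index at least 2, or on some y. Hence the
  coordinates along x_1 and x_2 of a bracket in the whole algebra see only the action of
  \<open>SL2\<close>.\<close>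

lemma lbr_GN_GX1: "lbr (GN n a b) u v (GX 1 i) = 0"
proof -
  have "gn_table n a b p q (GX 1 i) = 0" for p q
    by (cases p; cases q) (auto simp: bvec_def scaleC_fun_def scaleC_complex_def)
  then show ?thesis by (simp add: GN_def bilinear_ext_apply gn_br_def)
qed

lemma gn_br_GC: "gn_br n a b GC p = 0" "gn_br n a b p GC = 0"
  by (cases p; simp add: gn_br_def)+

lemma lbr_GN_GC: "lbr (GN n a b) (c *\<^sub>C bvec GC) v = 0" "lbr (GN n a b) v (c *\<^sub>C bvec GC) = 0"
  by (auto simp: GN_def bilinear_ext_apply fun_eq_iff bvec_def scaleC_fun_def scaleC_complex_def
      gn_br_GC if_distrib if_distribR intro!: sum.neutral)

lemma sl2_act_GC: "sl2_act n g (c *\<^sub>C bvec GC) = 0"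
proof -
  have "sl2_gn p GC = 0" for p by (cases p) simp_all
  then show ?thesis
    by (auto simp: sl2_act_def bilinear_ext_apply fun_eq_iff bvec_def scaleC_fun_def
        scaleC_complex_def intro!: sum.neutral)
qed

text \<open>x_1 and x_2 span a copy of the standard representation. The matrix of \<open>g\<close>
  on these coordinates is traceless, which makes the determinant-like \<open>cross_form\<close>
  invariant.\<close>

lemma sl2_act_GX1:
  assumes "1 \<le> n"
  shows "sl2_act n g u (GX 1 1) = g H * u (GX 1 1) + g E * u (GX 1 2)"
    and "sl2_act n g u (GX 1 2) = g F * u (GX 1 1) - g H * u (GX 1 2)"
proof -
  have E: "sl2_gn E p (GX 1 1) = (if p = GX 1 2 then 1 else 0)"
    "sl2_gn E p (GX 1 2) = 0"
    and F: "sl2_gn F p (GX 1 1) = 0"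
    "sl2_gn F p (GX 1 2) = (if p = GX 1 1 then 1 else 0)"
    and H: "sl2_gn H p (GX 1 1) = (if p = GX 1 1 then 1 else 0)"
    "sl2_gn H p (GX 1 2) = (if p = GX 1 2 then -1 else 0)"
    if "p \<in> gn_basis n" for p
    using that by (cases p; auto simp: bvec_def scaleC_fun_def scaleC_complex_def)+
  have if_simp: "x * (if P then y else 0) = (if P then x * y else 0)" for x y :: complex and P
    by simp
  show "sl2_act n g u (GX 1 1) = g H * u (GX 1 1) + g E * u (GX 1 2)"
    "sl2_act n g u (GX 1 2) = g F * u (GX 1 1) - g H * u (GX 1 2)"
    using assms by (simp_all add: sl2_act_def bilinear_ext_apply E[unfolded One_nat_def]
        F[unfolded One_nat_def] H[unfolded One_nat_def] if_simp cong: sum.cong)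
qed

definition central :: "nat \<Rightarrow> (sl2 \<Rightarrow> complex) \<times> (nat \<Rightarrow> gn \<Rightarrow> complex)" where
  "central m = (0, (\<lambda>_. 0)(m := bvec GC))"

lemma central_mem: "m \<in> {1..k} \<Longrightarrow> c *\<^sub>C central m \<in> lspace (sl2_GN n k a b s)"
  by (auto simp: lspace_sl2_GN central_def bvec_def scaleC_prod_def scaleC_fun_def scaleC_complex_def)

text \<open>Another factor acts on the factor m through \<open>ad\<close> of that factor, and c of
  the factor m acts on another factor as the c there. So only brackets with c occur, which vanish,
  and \<open>SL2\<close> annihilates c.\<close>

lemma lbr_central:
  assumes m: "m \<in> {1..k}" and x: "x \<in> lspace (sl2_GN n k a b s)"
  shows "lbr (sl2_GN n k a b s) x (c *\<^sub>C central m) = 0"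
proof (rule prod_eqI)
  have k: "1 \<le> k" using m by simp
  let ?d = "\<lambda>r. if r = m then c else 0"
  have c: "fst (c *\<^sub>C central m) = 0" "\<And>r. snd (c *\<^sub>C central m) r = ?d r *\<^sub>C bvec GC"
    by (auto simp: central_def scaleC_prod_def scaleC_fun_def)
  show "fst (lbr (sl2_GN n k a b s) x (c *\<^sub>C central m)) = fst 0"
    using bilinear_ext_scale_right[of _ _ _ _ 0 0]
    by (simp add: lbr_sl2_GN SL2_def c)
  have "snd (lbr (sl2_GN n k a b s) x (c *\<^sub>C central m)) r = 0" for r
    unfolding snd_lbr_sl2_GN[OF k x central_mem[OF m]] c
    by (simp add: lbr_GN_GC sl2_act_GC sl2_act_zero_left)
  then show "snd (lbr (sl2_GN n k a b s) x (c *\<^sub>C central m)) = snd 0"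
    by (auto simp: fun_eq_iff)
qed

text \<open>With \<open>\<xi>\<^sub>i\<close> and \<open>\<eta>\<^sub>i\<close> the coordinates along the generators \<open>x\<^sub>i\<close> of the factors \<open>M\<close> and \<open>q\<close>,
  this is the \<open>\<ss>\<ll>\<^sub>2\<close>-invariant form \<open>\<xi>\<^sub>1 \<and> \<eta>\<^sub>2 - \<xi>\<^sub>2 \<and> \<eta>\<^sub>1\<close>.\<close>

definition cross_form ::
  "nat \<Rightarrow> nat \<Rightarrow> (nat \<Rightarrow> gn \<Rightarrow> complex) \<Rightarrow> (nat \<Rightarrow> gn \<Rightarrow> complex) \<Rightarrow> complex"
where
  "cross_form M q u v =
     u M (GX 1 1) * v q (GX 1 2) - u M (GX 1 2) * v q (GX 1 1)
     - v M (GX 1 1) * u q (GX 1 2) + v M (GX 1 2) * u q (GX 1 1)"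

lemma cross_form_add:
  "cross_form M q (u + u') v = cross_form M q u v + cross_form M q u' v"
  "cross_form M q v (u + u') = cross_form M q v u + cross_form M q v u'"
  by (simp_all add: cross_form_def algebra_simps)

lemma cross_form_scale:
  "cross_form M q (c *\<^sub>C u) v = c * cross_form M q u v"
  "cross_form M q v (c *\<^sub>C u) = c * cross_form M q v u"
  by (simp_all add: cross_form_def scaleC_fun_def scaleC_complex_def algebra_simps)

definition cross_cochain ::
  "('a \<times> (nat \<Rightarrow> gn \<Rightarrow> complex)) set \<Rightarrow> nat \<Rightarrow> nat \<Rightarrow> 'a \<times> (nat \<Rightarrow> gn \<Rightarrow> complex)
     \<Rightarrow> 'a \<times> (nat \<Rightarrow> gn \<Rightarrow> complex) \<Rightarrow> (sl2 \<Rightarrow> complex) \<times> (nat \<Rightarrow> gn \<Rightarrow> complex)"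
where
  "cross_cochain S M q x y =
     (if x \<in> S \<and> y \<in> S then cross_form M q (snd x) (snd y) *\<^sub>C central M else 0)"

lemma cross_cochain_mem_cocycles2:
  assumes n: "5 \<le> n" and M: "M \<in> {1..k}"
  shows "cross_cochain (lspace (sl2_GN n k a b s)) M q \<in> cocycles2 (sl2_GN n k a b s)"
proof -
  let ?L = "sl2_GN n k a b s"
  let ?\<omega> = "cross_cochain (lspace ?L) M q"
  have k: "1 \<le> k" using M by simp
  note sub = subspace_sl2_GN[OF k, of n a b s]
  have snd_scale: "snd (c *\<^sub>C x) = c *\<^sub>C snd x"
    for c and x :: "(sl2 \<Rightarrow> complex) \<times> (nat \<Rightarrow> gn \<Rightarrow> complex)"
    by (simp add: scaleC_prod_def)
  have "linear_on (lspace ?L) (lspace ?L) (?\<omega> x)"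
    "linear_on (lspace ?L) (lspace ?L) (\<lambda>y. ?\<omega> y x)" if "x \<in> lspace ?L" for x
    using that cvs.subspace_add[OF sub] cvs.subspace_scale[OF sub] central_mem[OF M]
    by (simp_all add: linear_on_def cross_cochain_def cross_form_add cross_form_scale snd_scale
        scaleC_add_left scaleC_scaleC)
  then have cochain: "?\<omega> \<in> cochains2 ?L"
    by (auto simp: cochains2_def cross_cochain_def cross_form_def)
  have gen: "snd (lbr ?L x y) m (GX 1 i) =
      sl2_act n (fst x) (snd y m) (GX 1 i) - sl2_act n (fst y) (snd x m) (GX 1 i)"
    if "x \<in> lspace ?L" "y \<in> lspace ?L" for x y m i
    unfolding snd_lbr_sl2_GN[OF k that] by (simp add: sum_fun_apply lbr_GN_GX1[of n, simplified])
  have "coboundary2 ?L ?\<omega> x y z = 0" for x y z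
  proof (cases "x \<in> lspace ?L \<and> y \<in> lspace ?L \<and> z \<in> lspace ?L")
    case True
    \<comment> \<open>By \<open>gen\<close> the terms group by the \<open>SL2\<close> part of one
      argument. The part g of x, for instance, contributes B(g y, z) + B(y, g z), which is 0 by
      invariance; the outer terms of the differential vanish since c is central.\<close>
    have invariant: "cross_form M q (snd (lbr ?L x z)) (snd y)
        = cross_form M q (snd (lbr ?L x y)) (snd z) + cross_form M q (snd (lbr ?L y z)) (snd x)"
      using True n by (simp add: cross_form_def gen[unfolded One_nat_def]
          sl2_act_GX1[unfolded One_nat_def] algebra_simps)
    show ?thesis
      using True M n k
      by (simp add: coboundary2_def cross_cochain_def lbr_central lbr_sl2_GN_closed invariant
          cvs.scale_left_distrib)
  next
    case False
    then show ?thesis by (auto simp: coboundary2_def)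
  qed
  then show ?thesis
    using cochain by (auto simp: cocycles2_def fun_eq_iff)
qed

section \<open>Non-triviality of the cocycle\<close>

lemma lbr_GN_bvec_left:
  assumes "p \<in> gn_basis n"
  shows "lbr (GN n a b) (bvec p) v r = (\<Sum>q\<in>gn_basis n. v q * gn_br n a b p q r)"
proof -
  have "lbr (GN n a b) (bvec p) v r
      = (\<Sum>p'\<in>gn_basis n. if p' = p then (\<Sum>q\<in>gn_basis n. v q * gn_br n a b p q r) else 0)"
    unfolding GN_def lie_alg.select_convs bilinear_ext_apply
    by (intro sum.cong refl) (auto simp: bvec_def)
  then show ?thesis using assms by simp
qed

lemma lbr_GN_x1_GC:
  assumes "5 \<le> n"
  shows "lbr (GN n a b) (bvec (GX 1 1)) v GC = v (GX 1 2)"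
proof -
  have "gn_br n a b (GX 1 1) q GC = (if q = GX 1 2 then 1 else 0)" for q
    by (cases q) (auto simp: gn_br_def bvec_def fun_eq_iff scaleC_fun_def scaleC_complex_def)
  moreover have "v q * (if q = GX 1 2 then 1 else 0) = (if q = GX 1 2 then v q else 0)" for q
    by simp
  ultimately show ?thesis
    using assms lbr_GN_bvec_left[of "GX 1 1" n a b v GC] by simp
qed

text \<open>Only [x_2, y_1] = z_2 produces z_2 from y_1; the sign comes from y_1 being the second
  argument there.\<close>

lemma lbr_GN_y1_z2:
  assumes "5 \<le> n"
  shows "lbr (GN n a b) (bvec (GY 1 1)) v (GX 2 2) = - v (GX 1 2)"
proof -
  have "gn_br n a b (GY 1 1) q (GX 2 2) = (if q = GX 1 2 then - 1 else 0)"
    if "q \<in> gn_basis n" for q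
    using assms that
    by (cases q) (auto simp: gn_br_def bvec_def fun_eq_iff scaleC_fun_def scaleC_complex_def)
  then have "lbr (GN n a b) (bvec (GY 1 1)) v (GX 2 2)
      = (\<Sum>q\<in>gn_basis n. if q = GX 1 2 then - v q else 0)"
    using assms by (subst lbr_GN_bvec_left) (simp, intro sum.cong refl, simp)
  then show ?thesis using assms by simp
qed

text \<open>The value \<psi>(w) may have a component in \<open>SL2\<close>, which acts on the
  generator in the factor \<open>M\<close>. This fact and the next show that the two coordinates to
  be compared do not see that contribution.\<close>

lemma sl2_act_GC_coord: "sl2_act n g u GC = 0"
proof -
  have "sl2_gn x p GC = 0" for x p
    by (cases x; cases p) (simp_all add: bvec_def scaleC_fun_def scaleC_complex_def)
  then show ?thesis by (simp add: sl2_act_def bilinear_ext_apply)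
qed

lemma sl2_act_y_z: "sl2_act n g (bvec (GY 1 1)) (GX 2 i) = 0"
proof -
  have "sl2_gn x (GY 1 1) (GX 2 i) = 0" for x
    by (cases x) (simp_all add: bvec_def scaleC_fun_def scaleC_complex_def)
  then show ?thesis
    by (auto simp: sl2_act_def bilinear_ext_apply bvec_def intro!: sum.neutral)
qed

text \<open>The difference of the copies of a vector in the factors \<open>M\<close> and \<open>q\<close> commutes with the
  factor \<open>q\<close>, because the copy in \<open>M\<close> acts there as the copy in \<open>q\<close>.\<close>

lemma lbr_difference:
  assumes M: "M \<in> {1..k}" and q: "q \<in> {1..k}" and acts: "acts_on s M q"
    and g: "g \<in> lspace (GN n 0 0)" and h: "h \<in> lspace (GN n 0 0)"
  shows "lbr (sl2_GN n k a b s) (0, (\<lambda>_. 0)(M := g, q := - g)) (0, (\<lambda>_. 0)(q := h)) = 0"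
proof (rule prod_eqI)
  let ?L = "sl2_GN n k a b s"
  let ?x = "(0, (\<lambda>_. 0)(M := g, q := - g)) :: (sl2 \<Rightarrow> complex) \<times> (nat \<Rightarrow> gn \<Rightarrow> complex)"
  let ?w = "(0, (\<lambda>_. 0)(q := h)) :: (sl2 \<Rightarrow> complex) \<times> (nat \<Rightarrow> gn \<Rightarrow> complex)"
  have k: "1 \<le> k" and ne: "M \<noteq> q" "\<not> acts_on s q M" "\<not> acts_on s q q"
    using M acts by (auto simp: acts_on_def)
  have x: "?x \<in> lspace ?L" and w: "?w \<in> lspace ?L"
    using k M q g h by (auto simp: lspace_sl2_GN mem_lspace_GN)
  show "fst (lbr ?L ?x ?w) = fst 0"
    by (simp add: lbr_sl2_GN SL2_def bilinear_ext_zero_left)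
  have "snd (lbr ?L ?x ?w) m = 0" for m
  proof -
    let ?G = "lbr (GN n (a m) (b m))"
    consider "m = q" | "m = M" | "m \<noteq> q" "m \<noteq> M" by blast
    then show ?thesis
    proof cases
      case 1
      have "(\<Sum>r | r \<in> {1..k} \<and> acts_on s r q. ?G (snd ?x r) h - ?G (snd ?w r) (- g))
          = (\<Sum>r | r \<in> {1..k} \<and> acts_on s r q. if r = M then ?G g h else 0)"
        using ne by (intro sum.cong refl) (auto simp: lbr_GN_zero_left)
      \<comment> \<open>This is the action of the copy of g in \<open>M\<close>; it cancels the
        bracket of \<open>- g\<close> and h inside the factor q.\<close>
      also have "\<dots> = ?G g h" using M acts by simp
      finally show ?thesis
        unfolding snd_lbr_sl2_GN[OF k x w] using q 1
        by (simp add: sl2_act_zero_left lbr_GN_uminus_left)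
    next
      case 2
      have "(\<Sum>r | r \<in> {1..k} \<and> acts_on s r M. ?G (snd ?x r) (snd ?w M) - ?G (snd ?w r) g) = 0"
        using ne by (intro sum.neutral) (auto simp: lbr_GN_zero_left lbr_GN_zero_right)
      then show ?thesis
        unfolding snd_lbr_sl2_GN[OF k x w] using 2 ne
        by (simp add: sl2_act_zero_left lbr_GN_zero_right)
    next
      case 3
      then show ?thesis
        unfolding snd_lbr_sl2_GN[OF k x w]
        by (simp add: sl2_act_zero_left lbr_GN_zero_left lbr_GN_zero_right)
    qed
  qed
  then show "snd (lbr ?L ?x ?w) = snd 0" by (auto simp: fun_eq_iff)
qed

lemma cross_cochain_not_coboundary:
  assumes n: "5 \<le> n" and M: "M \<in> {1..k}" and q: "q \<in> {1..k}" and acts: "acts_on s M q"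
    and top: "\<And>r. r \<in> {1..k} \<Longrightarrow> \<not> acts_on s r M"
  shows "cross_cochain (lspace (sl2_GN n k a b s)) M q \<notin> coboundaries2 (sl2_GN n k a b s)"
proof
  let ?L = "sl2_GN n k a b s"
  let ?\<omega> = "cross_cochain (lspace ?L) M q"
  assume "?\<omega> \<in> coboundaries2 ?L"
  then obtain \<psi> where \<psi>: "\<psi> \<in> cochains1 ?L" "?\<omega> = coboundary1 ?L \<psi>"
    by (auto simp: coboundaries2_def)
  define d :: "gn \<Rightarrow> (sl2 \<Rightarrow> complex) \<times> (nat \<Rightarrow> gn \<Rightarrow> complex)"
    where "d p = (0, (\<lambda>_. 0)(M := bvec p, q := - bvec p))" for p
  define w :: "(sl2 \<Rightarrow> complex) \<times> (nat \<Rightarrow> gn \<Rightarrow> complex)"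
    where "w = (0, (\<lambda>_. 0)(q := bvec (GX 1 2)))"
  have k: "1 \<le> k" and ne: "M \<noteq> q"
    using M acts by (auto simp: acts_on_def)
  have no: "{r. r \<in> {1..k} \<and> acts_on s r M} = {}" using top by auto
  have w: "w \<in> lspace ?L" and d: "d p \<in> lspace ?L" if "p \<in> gn_basis n" for p
    using k M q n that by (auto simp: lspace_sl2_GN w_def d_def bvec_def)
  have mem: "\<psi> x \<in> lspace ?L" if "x \<in> lspace ?L" for x
    using \<psi>(1) that by (simp add: cochains1_def linear_on_def)
  have \<psi>0: "\<psi> 0 = 0"
  proof -
    have "\<psi> (0 *\<^sub>C 0) = 0 *\<^sub>C \<psi> 0"
      using \<psi>(1) cvs.subspace_0[OF subspace_sl2_GN[OF k]] unfolding cochains1_def linear_on_def by blast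
    then show ?thesis by simp
  qed
  let ?G = "lbr (GN n (a M) (b M))"
  have key: "snd (?\<omega> (d p) w) M = ?G (bvec p) (snd (\<psi> w) M) - sl2_act n (fst (\<psi> w)) (bvec p)"
    if p: "p \<in> gn_basis n" for p
  proof -
    have w': "w \<in> lspace ?L" using w[OF p] .
    have "lbr ?L (d p) w = 0"
      unfolding d_def w_def using n p
      by (intro lbr_difference[OF M q acts]) (auto simp: mem_lspace_GN bvec_def)
    then have "?\<omega> (d p) w = lbr ?L (d p) (\<psi> w) - lbr ?L w (\<psi> (d p))"
      unfolding \<psi>(2) using d[OF p] w' \<psi>0 by (simp add: coboundary1_def)
    moreover have "snd (lbr ?L (d p) (\<psi> w)) M
        = ?G (bvec p) (snd (\<psi> w) M) - sl2_act n (fst (\<psi> w)) (bvec p)"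
      unfolding snd_lbr_sl2_GN[OF k d[OF p] mem[OF w']] no using M ne
      by (simp add: d_def sl2_act_zero_left)
    \<comment> \<open>w has neither an \<open>SL2\<close> component nor one in \<open>M\<close>, and
      its factor q does not act on \<open>M\<close>.\<close>
    moreover have "snd (lbr ?L w (\<psi> (d p))) M = 0"
      unfolding snd_lbr_sl2_GN[OF k w' mem[OF d[OF p]]] no using M ne
      by (simp add: w_def sl2_act_zero_left sl2_act_zero_right lbr_GN_zero_left)
    ultimately show ?thesis by simp
  qed
  have x1: "GX 1 1 \<in> gn_basis n" and y1: "GY 1 1 \<in> gn_basis n" using n by auto
  \<comment> \<open>All values of the cochain are multiples of c, so they have no coordinate along
    z_2.\<close>
  have "snd (?\<omega> (d (GY 1 1)) w) M (GX 2 2) = 0"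
    by (simp add: cross_cochain_def scaleC_prod_def scaleC_fun_def scaleC_complex_def central_def bvec_def)
  then have "snd (\<psi> w) M (GX 1 2) = 0"
    using lbr_GN_y1_z2[OF n, of "a M" "b M" "snd (\<psi> w) M"] sl2_act_y_z[of n "fst (\<psi> w)" 2]
    unfolding key[OF y1] by simp
  \<comment> \<open>The one surviving product in \<open>cross_form\<close> pairs x_1 in the
    \<open>M\<close> part of \<open>d (GX 1 1)\<close> with x_2 in the q part of w.\<close>
  moreover have "snd (?\<omega> (d (GX 1 1)) w) M GC = 1"
    using d[OF x1] w[OF x1] ne
    by (simp add: cross_cochain_def scaleC_prod_def scaleC_fun_def scaleC_complex_def central_def
        cross_form_def d_def w_def bvec_def)
  then have "snd (\<psi> w) M (GX 1 2) = 1"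
    using lbr_GN_x1_GC[OF n, of "a M" "b M" "snd (\<psi> w) M"]
    unfolding key[OF x1] by (simp add: sl2_act_GC_coord)
  ultimately show False by simp
qed

theorem theorem3p4:
  fixes n k :: nat and a b :: "nat \<Rightarrow> complex" and s :: "nat \<Rightarrow> side"
  assumes "n \<ge> 5" and "odd n" and "k \<ge> 2"
  shows "dim_H2 (sl2_GN n k a b s) \<ge> 1"
proof -
  let ?L = "sl2_GN n k a b s"
  have k: "1 \<le> k" using assms by simp
  obtain M where M: "M \<in> {1..k}" "\<And>r. r \<in> {1..k} \<Longrightarrow> \<not> acts_on s r M"
    "\<And>r. r \<in> {1..k} \<Longrightarrow> r \<noteq> M \<Longrightarrow> acts_on s M r"
    using exists_top_factor[OF k] by metis
  \<comment> \<open>A second factor exists because k is at least 2; one of 1 and 2 differs from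
    \<open>M\<close>.\<close>
  obtain q where q: "q \<in> {1..k}" "q \<noteq> M"
    using assms(3) by (cases "M = 1") (auto intro: that[of 1] that[of 2])
  obtain T where "finite T" "cochains2 ?L \<subseteq> cvs.span T"
    using cochains2_sl2_GN_finite_span[OF k] by metis
  moreover have "cocycles2 ?L \<subseteq> cochains2 ?L" by (auto simp: cocycles2_def)
  ultimately have T: "finite T" "cocycles2 ?L \<subseteq> cvs.span T" by auto
  show ?thesis
    unfolding dim_H2_def H2_def
  proof (rule dim_quotient_space_pos[OF _ _ T])
    show "cvs.subspace (cocycles2 ?L)" "cvs.subspace (coboundaries2 ?L)"
      using k
      by (auto intro!: subspace_cocycles2 subspace_coboundaries2 subspace_sl2_GN linear_lbr_sl2_GN)
    show "cross_cochain (lspace ?L) M q \<in> cocycles2 ?L"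
      by (rule cross_cochain_mem_cocycles2[OF assms(1) M(1)])
    show "cross_cochain (lspace ?L) M q \<notin> coboundaries2 ?L"
      by (rule cross_cochain_not_coboundary[OF assms(1) M(1) q(1) M(3)[OF q] M(2)])
  qed
qed

end
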